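(* Let $(X,\mathbb P_x)_{x\in D}$ be a stochastically continuous affine process on $D=\mathbb R_+^m\times\mathbb R^n$ with admissible parameters $(\alpha,\beta,\gamma,\kappa)$. The following are equivalent: (i) $(X,\mathbb P_x)_{x\in D}$ is conservative, i.e. $p_t(x,D)=1$ for all $t\ge0$, $x\in D$; (ii) $R_0(0)=0$ and there is no non-trivial $\mathbb R_-^m$-valued local solution $g$ (on some interval $[0,T)$, $T>0$) of $\partial_t g(t)=R_{\mathcal I}(g(t),0)$ with $g(0)=0$. Moreover, each of these statements implies $R(0)=0$ (equivalently, together with $R_0(0)=0$, $\gamma=0$).
   Context: Setting: $m,n\ge0$, $d=m+n\ge1$, $D=\mathbb R_+^m\times\mathbb R^n$. $(X,\mathbb P_x)_{x\in D}$ is a time-homogeneous Markov process with values in the one-point compactification $D_\Delta$ and transition function $p_t(x,d\xi)$. It is stochastically continuous if $p_s(x,\cdot)\to p_t(x,\cdot)$ weakly as $s\to t$ for all $(t,x)$, and affine if for all $t\ge0$, $u\in i\mathbb R^d$ there are $\psi_0(t,u)\in\mathbb C$, $\psi(t,u)\in\mathbb C^d$ with $\int_D e^{\langle u,\xi\rangle}p_t(x,d\xi)=\exp(\psi_0(t,u)+\langle\psi(t,u),x\rangle)$ for all $x\in D$. Truncation function $h=(h_1,\dots,h_d)$: $h_k(\xi)=0$ if $\xi_k=0$, else $(1\wedge|\xi_k|)\xi_k/|\xi_k|$. Parameters $(\alpha,\beta,\gamma,\kappa)$ are admissible if: $\alpha=(\alpha_0,\dots,\alpha_d)$ are symmetric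 positive semidefinite $d\times d$ matrices with $\alpha_j=0$ for $j\ge m+1$ and $\alpha_j^{kl}=0$ for $0\le j\le m$, $1\le k,l\le m$ unless $k=l=j$; $\kappa=(\kappa_0,\dots,\kappa_d)$ are Borel measures on $D\setminus\{0\}$ with $\kappa_j=0$ for $j\ge m+1$, $\int\|h(\xi)\|^2\kappa_j(d\xi)<\infty$ for $0\le j\le m$ and $\int|h_k(\xi)|\kappa_j(d\xi)<\infty$ for $0\le j\le m$, $1\le k\le m$, $k\ne j$; $\beta=(\beta_0,\dots,\beta_d)$, $\beta_j\in\mathbb R^d$, with $\beta_j^k=0$ for $j\ge m+1$, $1\le k\le m$, and $\beta_j^k-\int h_k(\xi)\kappa_j(d\xi)\ge0$ for $0\le j\le m$, $1\le k\le m$, $k\ne j$; $\gamma=(\gamma_0,\dots,\gamma_d)$ with $\gamma_j\ge0$ and $\gamma_j=0$ for $j\ge m+1$. For $0\le i\le d$, $$R_i(u)=\tfrac12\langle\alpha_iu,u\rangle+\langle\beta_i,u\rangle-\gamma_i+\int_{D\setminus\{0\}}\big(e^{\langle u,\xi\rangle}-1-\langle u,h(\xi)\rangle\big)\kappa_i(d\xi),$$ $R=(R_1,\dots,R_d)$. Every stochastically continuous affine process has unique admissible parameters such that $\partial_t\psi=R(\psi)$, $\psi(0,u)=u$, $\partial_t\psi_0=R_0(\psi)$, $\psi_0(0,u)=0$; conversely each admissible parameter set determines a unique stochastically continuous affine process. Notation: $\mathcal I=\{1,\dots,m\}$, $R_{\mathcal I}=(R_1,\dots,R_m)$, and $R_{\mathcal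 I}(v,0)$ means $R_{\mathcal I}$ evaluated at $(v_1,\dots,v_m,0,\dots,0)$, well defined for $v\in\mathbb R_-^m$. *)

theory Defs
  imports "HOL-Probability.Probability"
begin

text \<open>State space D = R_+^m x R^n.  Coordinates are indexed by a finite type 'd
  (so d = CARD('d) >= 1); the set I of 'd collects the m nonnegative coordinates,
  the remaining n = CARD('d) - card I coordinates are real.  Parameter indices
  0,1,...,d are encoded as 'd option, with None standing for the index 0.\<close>

definition stateD :: "'d::finite set \<Rightarrow> (real^'d) set" where
  "stateD I = {x. \<forall>i\<in>I. 0 \<le> x $ i}"

definition trunc_h :: "real^'d::finite \<Rightarrow> real^'d" where
  "trunc_h \<xi> = (\<chi> k. if \<xi> $ k = 0 then 0
                        else min 1 \<bar>\<xi> $ k\<bar> * (\<xi> $ k / \<bar>\<xi> $ k\<bar>))"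

text \<open>Transition function of a time-homogeneous Markov process on D with values in
  the one-point compactification: sub-probability kernels on D (missing mass = mass
  at the cemetery point), p_0(x,.) = delta_x, Chapman-Kolmogorov.\<close>
definition transition_function ::
  "'d::finite set \<Rightarrow> (real \<Rightarrow> real^'d \<Rightarrow> (real^'d) measure) \<Rightarrow> bool" where
  "transition_function I p \<longleftrightarrow>
     (\<forall>t\<ge>0. \<forall>x\<in>stateD I. sets (p t x) = sets borel \<and> subprob_space (p t x)
                \<and> emeasure (p t x) (UNIV - stateD I) = 0) \<and>
     (\<forall>t\<ge>0. \<forall>A\<in>sets borel.
         (\<lambda>x. emeasure (p t x) A) \<in> borel_measurable (restrict_space borel (stateD I))) \<and>
     (\<forall>x\<in>stateD I. p 0 x = return borel x) \<and>
     (\<forall>s\<ge>0. \<forall>t\<ge>0. \<forall>x\<in>stateD I. \<forall>A\<in>sets borel.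
         emeasure (p (s + t) x) A = (\<integral>\<^sup>+ y. emeasure (p t y) A \<partial>p s x))"

text \<open>Stochastic continuity: weak convergence on the one-point compactification D_Delta,
  i.e. convergence of integrals of all continuous functions on D_Delta; these are
  exactly constants plus continuous functions on D vanishing at infinity, and the
  total mass on D_Delta is 1, so it amounts to the following.\<close>
definition stoch_continuous ::
  "'d::finite set \<Rightarrow> (real \<Rightarrow> real^'d \<Rightarrow> (real^'d) measure) \<Rightarrow> bool" where
  "stoch_continuous I p \<longleftrightarrow>
     (\<forall>t\<ge>0. \<forall>x\<in>stateD I. \<forall>f :: real^'d \<Rightarrow> real.
        continuous_on (stateD I) f \<and>
        (\<forall>e>0. \<exists>r. \<forall>y\<in>stateD I. r \<le> norm y \<longrightarrow> \<bar>f y\<bar> < e) \<longrightarrow>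
        ((\<lambda>s. \<integral>y. f y \<partial>p s x) \<longlongrightarrow> (\<integral>y. f y \<partial>p t x)) (at t within {0..}))"

text \<open>Affine property with given functions psi0, psi; u = i v with v real.\<close>
definition affine_with ::
  "'d::finite set \<Rightarrow> (real \<Rightarrow> real^'d \<Rightarrow> (real^'d) measure)
     \<Rightarrow> (real \<Rightarrow> real^'d \<Rightarrow> complex) \<Rightarrow> (real \<Rightarrow> real^'d \<Rightarrow> complex^'d) \<Rightarrow> bool" where
  "affine_with I p psi0 psi \<longleftrightarrow>
     (\<forall>t\<ge>0. \<forall>v. \<forall>x\<in>stateD I.
        (\<integral>\<xi>. exp (\<Sum>k\<in>UNIV. (\<i> * of_real (v $ k)) * of_real (\<xi> $ k)) \<partial>p t x)
          = exp (psi0 t v + (\<Sum>k\<in>UNIV. psi t v $ k * of_real (x $ k))))"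

definition admissible ::
  "'d::finite set \<Rightarrow> ('d option \<Rightarrow> real^'d^'d) \<Rightarrow> ('d option \<Rightarrow> real^'d)
     \<Rightarrow> ('d option \<Rightarrow> real) \<Rightarrow> ('d option \<Rightarrow> (real^'d) measure) \<Rightarrow> bool" where
  "admissible I alpha beta gamma kappa \<longleftrightarrow>
     \<comment> \<open>alpha\<close>
     (\<forall>j. transpose (alpha j) = alpha j \<and> (\<forall>y. 0 \<le> y \<bullet> (alpha j *v y))) \<and>
     (\<forall>i. i \<notin> I \<longrightarrow> alpha (Some i) = 0) \<and>
     (\<forall>j. (j = None \<or> (\<exists>i\<in>I. j = Some i)) \<longrightarrow>
        (\<forall>k\<in>I. \<forall>l\<in>I. \<not> (j = Some k \<and> j = Some l) \<longrightarrow> alpha j $ k $ l = 0)) \<and>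
     \<comment> \<open>kappa: Borel measures on D minus the origin\<close>
     (\<forall>j. sets (kappa j) = sets borel \<and>
          emeasure (kappa j) (UNIV - (stateD I - {0})) = 0) \<and>
     (\<forall>i. i \<notin> I \<longrightarrow> (\<forall>A. emeasure (kappa (Some i)) A = 0)) \<and>
     (\<forall>j. (j = None \<or> (\<exists>i\<in>I. j = Some i)) \<longrightarrow>
        (\<integral>\<^sup>+ \<xi>. ennreal ((norm (trunc_h \<xi>))\<^sup>2) \<partial>kappa j) < \<infinity> \<and>
        (\<forall>k\<in>I. j \<noteq> Some k \<longrightarrow> (\<integral>\<^sup>+ \<xi>. ennreal \<bar>trunc_h \<xi> $ k\<bar> \<partial>kappa j) < \<infinity>)) \<and>
     \<comment> \<open>beta\<close>
     (\<forall>i k. i \<notin> I \<longrightarrow> k \<in> I \<longrightarrow> beta (Some i) $ k = 0) \<and>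
     (\<forall>j. (j = None \<or> (\<exists>i\<in>I. j = Some i)) \<longrightarrow>
        (\<forall>k\<in>I. j \<noteq> Some k \<longrightarrow> 0 \<le> beta j $ k - (\<integral>\<xi>. trunc_h \<xi> $ k \<partial>kappa j))) \<and>
     \<comment> \<open>gamma\<close>
     (\<forall>j. 0 \<le> gamma j) \<and> (\<forall>i. i \<notin> I \<longrightarrow> gamma (Some i) = 0)"

definition Rfun ::
  "('d::finite option \<Rightarrow> real^'d^'d) \<Rightarrow> ('d option \<Rightarrow> real^'d)
     \<Rightarrow> ('d option \<Rightarrow> real) \<Rightarrow> ('d option \<Rightarrow> (real^'d) measure)
     \<Rightarrow> 'd option \<Rightarrow> complex^'d \<Rightarrow> complex" where
  "Rfun alpha beta gamma kappa i u =
     (1/2) * (\<Sum>k\<in>UNIV. \<Sum>l\<in>UNIV. of_real (alpha i $ k $ l) * u $ l * u $ k)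
     + (\<Sum>k\<in>UNIV. of_real (beta i $ k) * u $ k)
     - of_real (gamma i)
     + (\<integral>\<xi>. exp (\<Sum>k\<in>UNIV. u $ k * of_real (\<xi> $ k)) - 1
              - (\<Sum>k\<in>UNIV. u $ k * of_real (trunc_h \<xi> $ k)) \<partial>kappa i)"

end

theory Submission
  imports Defs "HOL-Complex_Analysis.Cauchy_Integral_Formula" "HOL-Real_Asymp.Real_Asymp"
begin

text \<open>
  The total mass of the transition kernel is the value at zero of its Fourier transform, so
  conservativeness says that the Riccati flow started at zero vanishes. Since that flow is real and
  lies in the negative cone, uniqueness for the real Riccati equation gives conservativeness at
  once.

  For the converse, the information on the imaginary axis is moved to real arguments by Poisson's
  formula for the left half plane: integration against a kernel that decays like the inverse fourth
  power of the frequency evaluates holomorphic functions of quadratic growth at -1. It shows that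
  the Laplace transform of the process is exponentially affine in the starting point and has at time
  zero the right derivative predicted by R. If g solves the real Riccati equation from zero,
  convexity of R turns (1 - e) g(t) - e exp (- C t) into a strict supersolution. Continuous
  induction in t, using Chapman-Kolmogorov, then bounds the Laplace transform of the process by this
  supersolution; as e tends to zero the Laplace transform tends to the total mass one, which forces
  g to vanish.
\<close>

section \<open>A Laplace kernel on the imaginary axis\<close>

lemma left_triangle_edge:
  assumes z: "z \<in> closed_segment x y" and R: "0 \<le> R"
    and xy: "(x, y) \<in> {(\<i> * of_real R, - of_real R), (- of_real R, - \<i> * of_real R)}"
  shows "Re z \<le> 0" and "R / 2 \<le> norm z"
proof -
  obtain s where s: "0 \<le> s" "s \<le> 1" "z = (1 - s) *\<^sub>R x + s *\<^sub>R y"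
    using z by (auto simp: in_segment)
  have "(Re z, Im z) = (- (s * R), (1 - s) * R) \<or> (Re z, Im z) = (- ((1 - s) * R), - (s * R))"
    using xy by (auto simp: s(3) algebra_simps)
  moreover have "0 \<le> s * R" "0 \<le> (1 - s) * R" using s R by auto
  ultimately have "Re z \<le> 0" "\<bar>Re z\<bar> + \<bar>Im z\<bar> = R" by (auto simp: algebra_simps)
  then show "Re z \<le> 0" "R / 2 \<le> norm z"
    using abs_Re_le_cmod[of z] abs_Im_le_cmod[of z] by auto
qed

lemma norm_contour_integral_left_triangle_edge_le:
  assumes xy: "(x, y) \<in> {(\<i> * of_real R, - of_real R), (- of_real R, - \<i> * of_real R)}"
    and R: "0 < R" "2 * r \<le> R" and integrable: "H contour_integrable_on linepath x y"
    and bound: "\<And>z. Re z \<le> 0 \<Longrightarrow> r \<le> norm z \<Longrightarrow> norm (H z) \<le> B / (norm z)\<^sup>2"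
  shows "norm (contour_integral (linepath x y) H) \<le> 8 * B / R"
proof -
  have B_nonneg: "0 \<le> B"
    using order_trans[OF norm_ge_zero bound[of "- of_real R"]] R by (simp add: zero_le_divide_iff)
  have "norm (contour_integral (linepath x y) H) \<le> B / (R / 2)\<^sup>2 * norm (y - x)"
  proof (rule contour_integral_bound_linepath[OF integrable])
    fix z assume "z \<in> closed_segment x y"
    from left_triangle_edge[OF this _ xy] have z: "Re z \<le> 0" "R / 2 \<le> norm z"
      using R by auto
    then have "norm (H z) \<le> B / (norm z)\<^sup>2" using R by (intro bound) auto
    also have "\<dots> \<le> B / (R / 2)\<^sup>2"
      using B_nonneg R z less_le_trans[OF _ z(2), of 0] by (intro divide_left_mono power_mono) auto
    finally show "norm (H z) \<le> B / (R / 2)\<^sup>2" .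
  qed (use B_nonneg in auto)
  also have "\<dots> \<le> B / (R / 2)\<^sup>2 * (R + R)"
    using xy R B_nonneg
    by (intro mult_left_mono order_trans[OF norm_triangle_ineq4]) (auto simp: norm_mult)
  also have "\<dots> = 8 * B / R" using R by (simp add: power2_eq_square)
  finally show ?thesis .
qed

lemma norm_contour_integral_half_plane_le:
  assumes H: "H holomorphic_on {z. Re z \<le> 0}"
    and bound: "\<And>z. Re z \<le> 0 \<Longrightarrow> r \<le> norm z \<Longrightarrow> norm (H z) \<le> B / (norm z)\<^sup>2"
    and R: "0 < R" "2 * r \<le> R"
  shows "norm (contour_integral (linepath (- \<i> * of_real R) (\<i> * of_real R)) H) \<le> 16 * B / R"
proof -
  let ?bottom = "- \<i> * of_real R" and ?top = "\<i> * of_real R" and ?left = "- complex_of_real R"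
  let ?I = "\<lambda>x y. contour_integral (linepath x y) H"
  have hull: "convex hull {?bottom, ?top, ?left} \<subseteq> {z. Re z \<le> 0}"
    by (rule hull_minimal) (use R in \<open>auto simp: convex_halfspace_Re_le\<close>)
  have "H contour_integrable_on linepath x y" if "{x, y} \<subseteq> {?bottom, ?top, ?left}" for x y
  proof (rule contour_integrable_continuous_linepath)
    have "closed_segment x y \<subseteq> convex hull {?bottom, ?top, ?left}"
      unfolding segment_convex_hull using that by (rule hull_mono)
    then show "continuous_on (closed_segment x y) H"
      using H hull by (meson continuous_on_subset holomorphic_on_imp_continuous_on)
  qed
  then have edges: "norm (?I ?top ?left) \<le> 8 * B / R" "norm (?I ?left ?bottom) \<le> 8 * B / R"
    by (auto intro!: norm_contour_integral_left_triangle_edge_le[OF _ R _ bound])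
  have "(H has_contour_integral 0)
      (linepath ?bottom ?top +++ linepath ?top ?left +++ linepath ?left ?bottom)"
    using H hull by (intro Cauchy_theorem_triangle) (rule holomorphic_on_subset)
  then have "?I ?bottom ?top + ?I ?top ?left + ?I ?left ?bottom = 0"
    by (rule has_chain_integral_chain_integral3)
  then have "?I ?bottom ?top = - (?I ?top ?left + ?I ?left ?bottom)"
    by (simp add: add_eq_0_iff2 add.assoc)
  then have "norm (?I ?bottom ?top) \<le> 8 * B / R + 8 * B / R"
    using norm_triangle_mono[OF edges] by (simp only: norm_minus_cancel)
  then show ?thesis by simp
qed

lemma contour_integral_imaginary_segment:
  assumes "0 < R" and f: "integrable lborel (\<lambda>w. f (\<i> * of_real w))"
  shows "contour_integral (linepath (- \<i> * of_real R) (\<i> * of_real R)) f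
      = \<i> * (\<integral>w. indicator {-R..R} w *\<^sub>R f (\<i> * of_real w) \<partial>lborel)"
proof -
  have "contour_integral (linepath (- \<i> * of_real R) (\<i> * of_real R)) f
      = \<i> * integral {-R..R} (\<lambda>w. f (Complex 0 w))"
    using assms(1) by (intro contour_integral_linepath_same_Re) auto
  also have "integral {-R..R} (\<lambda>w. f (Complex 0 w)) = (LINT w:{-R..R}|lborel. f (Complex 0 w))"
    using f by (intro set_borel_integral_eq_integral(2)[symmetric])
      (auto simp: Complex_eq set_integrable_def intro: integrable_mult_indicator)
  finally show ?thesis by (simp add: Complex_eq set_lebesgue_integral_def)
qed

lemma integral_symmetric_interval_tendsto:
  fixes f :: "real \<Rightarrow> 'a::{banach, second_countable_topology}"
  assumes "integrable lborel f"
  shows "((\<lambda>R. \<integral>w. indicator {-R..R} w *\<^sub>R f w \<partial>lborel) \<longlongrightarrow> (\<integral>w. f w \<partial>lborel)) at_top"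
proof (rule integral_dominated_convergence_at_top)
  show "integrable lborel (\<lambda>w. norm (f w))" using assms by simp
  show "\<forall>\<^sub>F R in at_top. AE w in lborel. norm (indicator {-R..R} w *\<^sub>R f w) \<le> norm (f w)"
    by (simp add: indicator_def)
  have "\<forall>\<^sub>F R in at_top. indicator {-R..R} w *\<^sub>R f w = f w" for w
    using eventually_ge_at_top[of "\<bar>w\<bar>"] by eventually_elim (auto simp: indicator_def)
  then show "AE w in lborel. ((\<lambda>R. indicator {-R..R} w *\<^sub>R f w) \<longlongrightarrow> f w) at_top"
    by (simp add: tendsto_eventually)
qed (use assms in auto)

lemma integral_imaginary_axis_eq_0:
  assumes H: "H holomorphic_on {z. Re z \<le> 0}"
    and bound: "\<And>z. Re z \<le> 0 \<Longrightarrow> r \<le> norm z \<Longrightarrow> norm (H z) \<le> B / (norm z)\<^sup>2"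
    and integrable: "integrable lborel (\<lambda>w. H (\<i> * of_real w))"
  shows "(\<integral>w. H (\<i> * of_real w) \<partial>lborel) = 0"
proof -
  let ?I = "\<lambda>R. \<integral>w. indicator {-R..R} w *\<^sub>R H (\<i> * of_real w) \<partial>lborel"
  have "(?I \<longlongrightarrow> 0) at_top"
  proof (rule Lim_null_comparison)
    show "\<forall>\<^sub>F R in at_top. norm (?I R) \<le> 16 * B / R"
      using eventually_gt_at_top[of 0] eventually_ge_at_top[of "2 * r"]
    proof eventually_elim
      case (elim R)
      have "norm (\<i> * ?I R) \<le> 16 * B / R"
        unfolding contour_integral_imaginary_segment[OF elim(1) integrable, symmetric]
        by (rule norm_contour_integral_half_plane_le[OF H bound elim])
      then show ?case by (simp add: norm_mult)
    qed
    show "((\<lambda>R. 16 * B / R) \<longlongrightarrow> 0) at_top" by real_asymp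
  qed
  with integral_symmetric_interval_tendsto[OF integrable] show ?thesis
    by (rule tendsto_unique[rotated]) simp
qed

lemma integrable_inverse_1_plus_square_lborel: "integrable lborel (\<lambda>x::real. 1 / (1 + x\<^sup>2))"
  and integral_inverse_1_plus_square_lborel: "(\<integral>x. 1 / (1 + x\<^sup>2) \<partial>lborel) = pi"
  using integrable_inverse_1_plus_square LBINT_inverse_1_plus_square
  by (simp_all add: set_integrable_def interval_lebesgue_integral_def set_lebesgue_integral_def
      inverse_eq_divide einterval_def)

lemma integrable_bounded_over_1_plus_square:
  fixes f :: "real \<Rightarrow> complex"
  assumes [measurable]: "f \<in> borel_measurable borel" and bound: "\<And>w. norm (f w) \<le> B"
  shows "integrable lborel (\<lambda>w. f w / of_real (1 + w\<^sup>2))"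
proof (rule Bochner_Integration.integrable_bound)
  show "integrable lborel (\<lambda>w. B * (1 / (1 + w\<^sup>2)))"
    by (intro integrable_mult_right integrable_inverse_1_plus_square_lborel)
  have "norm (f w / of_real (1 + w\<^sup>2)) \<le> B * (1 / (1 + w\<^sup>2))" for w
    using bound[of w]
    by (simp only: norm_divide norm_of_real) (simp add: divide_right_mono add_nonneg_nonneg)
  then show "AE w in lborel. norm (f w / of_real (1 + w\<^sup>2)) \<le> norm (B * (1 / (1 + w\<^sup>2)))"
    unfolding real_norm_def by (intro AE_I2 order_trans[OF _ abs_ge_self])
qed measurable

lemma norm_divide_one_minus_square_le:
  fixes z a :: complex
  assumes a: "norm a \<le> B" and z: "2 \<le> norm z"
  shows "norm (a / ((z + 1) * (1 - z))) \<le> 4 * B / (norm z)\<^sup>2"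
proof -
  have "norm z / 2 \<le> norm (z + 1)" using norm_triangle_ineq2[of z "-1"] z by simp
  moreover have "norm z / 2 \<le> norm (1 - z)"
    using norm_triangle_ineq2[of z 1] z by (simp add: norm_minus_commute)
  ultimately have "norm a / (norm (z + 1) * norm (1 - z)) \<le> B / (norm z / 2 * (norm z / 2))"
    using z less_le_trans[OF _ z, of 0] a order_trans[OF norm_ge_zero a]
    by (intro frac_le mult_mono mult_pos_pos) auto
  then show ?thesis by (simp add: norm_divide norm_mult power2_eq_square mult.commute)
qed

lemma Poisson_integral_half_plane:
  fixes F :: "complex \<Rightarrow> complex"
  assumes F: "F holomorphic_on {z. Re z \<le> 0}" and bound: "\<And>z. Re z \<le> 0 \<Longrightarrow> norm (F z) \<le> B"
  shows "(\<integral>w. F (\<i> * of_real w) / of_real (1 + w\<^sup>2) \<partial>lborel) = pi * F (-1)"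
proof -
  define H where "H z = (if z = -1 then deriv F (-1) else (F z - F (-1)) / (z - (-1))) / (1 - z)"
    for z
  have interior: "-1 \<in> interior {z. Re z \<le> 0}"
    by (rule interiorI[of "{z. Re z < 0}"]) (auto simp: open_halfspace_Re_lt)
  have H: "H holomorphic_on {z. Re z \<le> 0}"
    unfolding H_def by (intro holomorphic_intros pole_lemma F interior) auto
  have H_bound: "norm (H z) \<le> 8 * B / (norm z)\<^sup>2" if z: "Re z \<le> 0" "2 \<le> norm z" for z
  proof -
    have "norm (F z - F (-1)) \<le> 2 * B"
      using bound[OF z(1)] bound[of "-1"] norm_triangle_ineq4[of "F z" "F (-1)"] by simp
    from norm_divide_one_minus_square_le[OF this z(2)] show ?thesis using z by (auto simp: H_def)
  qed
  have H_axis: "H (\<i> * of_real w)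
      = F (\<i> * of_real w) / of_real (1 + w\<^sup>2) - F (-1) * of_real (1 / (1 + w\<^sup>2))" for w
  proof -
    have "(\<i> * of_real w + 1) * (1 - \<i> * of_real w) = complex_of_real (1 + w\<^sup>2)"
      by (simp add: algebra_simps power2_eq_square)
    moreover have "\<i> * of_real w \<noteq> -1" by (auto simp: complex_eq_iff)
    ultimately show ?thesis
      by (simp only: H_def if_False diff_minus_eq_add divide_divide_eq_left diff_divide_distrib
          of_real_divide of_real_1)
         (simp add: divide_inverse)
  qed
  have "continuous_on UNIV (\<lambda>w. F (\<i> * of_real w))"
    by (intro continuous_on_compose2[OF holomorphic_on_imp_continuous_on[OF F]] continuous_intros)
       auto
  then have integrable_F: "integrable lborel (\<lambda>w. F (\<i> * of_real w) / of_real (1 + w\<^sup>2))"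
    by (intro integrable_bounded_over_1_plus_square[where B = B] borel_measurable_continuous_onI
        bound) auto
  have integrable_const: "integrable lborel (\<lambda>w. F (-1) * complex_of_real (1 / (1 + w\<^sup>2)))"
    by (intro integrable_mult_right integrable_of_real integrable_inverse_1_plus_square_lborel)
  have "0 = (\<integral>w. H (\<i> * of_real w) \<partial>lborel)"
    using integrable_F integrable_const
    by (intro integral_imaginary_axis_eq_0[OF H H_bound, symmetric]) (auto simp: H_axis)
  also have "\<dots> = (\<integral>w. F (\<i> * of_real w) / of_real (1 + w\<^sup>2) \<partial>lborel)
      - F (-1) * complex_of_real (\<integral>w. 1 / (1 + w\<^sup>2) \<partial>lborel)"
    unfolding H_axis Bochner_Integration.integral_diff[OF integrable_F integrable_const]
    by (simp only: integral_mult_right_zero integral_complex_of_real)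
  finally show ?thesis by (simp add: integral_inverse_1_plus_square_lborel)
qed

text \<open>
  Chosen such that integrating \<open>f\<close> along the imaginary axis against this kernel is Poisson's formula
  for the bounded function \<open>4 f z / (1 - z)\<^sup>2\<close>, which agrees with \<open>f\<close> at \<open>-1\<close>.
\<close>

definition laplace_kernel :: "real \<Rightarrow> complex" where
  "laplace_kernel w = (4 / pi) / (of_real (1 + w\<^sup>2) * (1 - \<i> * of_real w)\<^sup>2)"

lemma laplace_kernel_measurable [measurable]: "laplace_kernel \<in> borel_measurable borel"
  unfolding laplace_kernel_def by measurable

lemma norm_laplace_kernel: "norm (laplace_kernel w) = (4 / pi) / (1 + w\<^sup>2)\<^sup>2"
proof -
  have "norm (complex_of_real (1 + w\<^sup>2)) = 1 + w\<^sup>2" "(norm (1 - \<i> * of_real w))\<^sup>2 = 1 + w\<^sup>2"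
    by (simp_all only: norm_of_real cmod_power2) (simp_all add: abs_of_nonneg)
  then show ?thesis
    by (simp only: laplace_kernel_def norm_divide norm_mult norm_power)
       (simp add: norm_divide power2_eq_square)
qed

lemma laplace_kernel_integral:
  fixes f :: "complex \<Rightarrow> complex"
  assumes f: "f holomorphic_on {z. Re z \<le> 0}"
    and bound: "\<And>z. Re z \<le> 0 \<Longrightarrow> norm (f z) \<le> C * (1 + (norm z)\<^sup>2)"
  shows "(\<integral>w. f (\<i> * of_real w) * laplace_kernel w \<partial>lborel) = f (-1)"
proof -
  let ?F = "\<lambda>z. (4 / pi) * f z / (1 - z)\<^sup>2"
  have "(\<integral>w. ?F (\<i> * of_real w) / of_real (1 + w\<^sup>2) \<partial>lborel) = pi * ?F (-1)"
  proof (rule Poisson_integral_half_plane)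
    show "?F holomorphic_on {z. Re z \<le> 0}" by (intro holomorphic_intros f) auto
    fix z :: complex assume z: "Re z \<le> 0"
    then have "1 + (norm z)\<^sup>2 \<le> (norm (1 - z))\<^sup>2"
      by (simp only: cmod_power2) (simp add: power2_eq_square algebra_simps)
    moreover have "0 \<le> C" using order_trans[OF norm_ge_zero bound[of 0]] by simp
    ultimately have "norm (f z) \<le> C * (norm (1 - z))\<^sup>2"
      by (intro order_trans[OF bound[OF z]] mult_left_mono)
    moreover have "0 < norm (1 - z)" using z by auto
    ultimately show "norm (?F z) \<le> 4 / pi * C"
      by (simp add: norm_divide norm_mult norm_power divide_le_eq mult_ac)
  qed
  moreover have "?F (\<i> * of_real w) / of_real (1 + w\<^sup>2) = f (\<i> * of_real w) * laplace_kernel w"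
    for w
    by (simp add: laplace_kernel_def mult_ac)
  ultimately show ?thesis by simp
qed

lemma integrable_laplace_kernel_quadratic:
  "integrable lborel (\<lambda>w. (1 + w\<^sup>2) * norm (laplace_kernel w))"
proof -
  have "integrable lborel (\<lambda>w::real. (4 / pi) * (1 / (1 + w\<^sup>2)))"
    by (intro integrable_mult_right integrable_inverse_1_plus_square_lborel)
  moreover have "(4 / pi) * (1 / (1 + w\<^sup>2)) = (1 + w\<^sup>2) * norm (laplace_kernel w)" for w
  proof -
    have "(4 / pi) * (1 / p) = p * ((4 / pi) / p\<^sup>2)" if "0 < p" for p
      using that by (simp add: power2_eq_square)
    then show ?thesis unfolding norm_laplace_kernel
      by (simp only: add_pos_nonneg zero_less_one zero_le_power2)
  qed
  ultimately show ?thesis by simp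
qed

lemma integrable_times_laplace_kernel:
  assumes [measurable]: "f \<in> borel_measurable borel" and f: "\<And>w. norm (f w) \<le> C * (1 + w\<^sup>2)"
  shows "integrable lborel (\<lambda>w. f w * laplace_kernel w)"
proof (rule Bochner_Integration.integrable_bound)
  show "integrable lborel (\<lambda>w. C * ((1 + w\<^sup>2) * norm (laplace_kernel w)))"
    by (intro integrable_mult_right integrable_laplace_kernel_quadratic)
  have "norm (f w * laplace_kernel w) \<le> C * ((1 + w\<^sup>2) * norm (laplace_kernel w))" for w
    by (simp add: norm_mult f mult_right_mono flip: mult.assoc)
  then show "AE w in lborel. norm (f w * laplace_kernel w)
      \<le> norm (C * ((1 + w\<^sup>2) * norm (laplace_kernel w)))"
    unfolding real_norm_def by (intro AE_I2 order_trans[OF _ abs_ge_self])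
qed auto

lemma integrable_times_exp_laplace_kernel:
  assumes [measurable]: "f \<in> borel_measurable borel" and "\<And>w. norm (f w) \<le> C * (1 + w\<^sup>2)"
  shows "integrable lborel (\<lambda>w. f w * iexp (w * s) * laplace_kernel w)"
  by (rule integrable_times_laplace_kernel[where C = C]) (use assms(2) in \<open>simp_all add: norm_mult\<close>)

lemma laplace_kernel_dominated_convergence:
  assumes [measurable]: "\<And>n. g n \<in> borel_measurable borel"
    and lim: "\<And>w. (\<lambda>n. g n w) \<longlonglongrightarrow> f w" and bound: "\<And>n w. norm (g n w) \<le> C * (1 + w\<^sup>2)"
  shows "(\<lambda>n. \<integral>w. g n w * laplace_kernel w \<partial>lborel) \<longlonglongrightarrow> (\<integral>w. f w * laplace_kernel w \<partial>lborel)"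
proof (rule integral_dominated_convergence)
  show "integrable lborel (\<lambda>w. C * ((1 + w\<^sup>2) * norm (laplace_kernel w)))"
    by (intro integrable_mult_right integrable_laplace_kernel_quadratic)
  show "AE w in lborel. (\<lambda>n. g n w * laplace_kernel w) \<longlonglongrightarrow> f w * laplace_kernel w"
    by (intro AE_I2 tendsto_intros lim)
  show "AE w in lborel. norm (g n w * laplace_kernel w)
      \<le> C * ((1 + w\<^sup>2) * norm (laplace_kernel w))" for n
    by (intro AE_I2) (simp add: norm_mult bound mult_right_mono flip: mult.assoc)
  have [measurable]: "f \<in> borel_measurable borel"
    using lim by (rule borel_measurable_LIMSEQ_metric[rotated]) measurable
  show "(\<lambda>w. f w * laplace_kernel w) \<in> borel_measurable lborel" by measurable
qed auto

lemma laplace_kernel_Fubini: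
  fixes f :: "'a \<Rightarrow> real \<Rightarrow> complex"
  assumes M: "sigma_finite_measure M"
    and [measurable]: "case_prod f \<in> borel_measurable (M \<Otimes>\<^sub>M borel)"
    and B: "integrable M B" and bound: "\<And>\<xi> w. norm (f \<xi> w) \<le> B \<xi> * (1 + w\<^sup>2)"
  shows "integrable lborel (\<lambda>w. (\<integral>\<xi>. f \<xi> w \<partial>M) * laplace_kernel w)"
    and "(\<integral>w. (\<integral>\<xi>. f \<xi> w \<partial>M) * laplace_kernel w \<partial>lborel)
        = (\<integral>\<xi>. (\<integral>w. f \<xi> w * laplace_kernel w \<partial>lborel) \<partial>M)"
proof -
  interpret sigma_finite_measure M by fact
  interpret pair_sigma_finite M lborel ..
  let ?g = "\<lambda>\<xi> w. f \<xi> w * laplace_kernel w"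
  define c where "c = (\<integral>w. (1 + w\<^sup>2) * norm (laplace_kernel w) \<partial>lborel)"
  have section_integrable: "integrable lborel (?g \<xi>)" if "\<xi> \<in> space M" for \<xi>
    using that by (intro integrable_times_laplace_kernel[OF _ bound]) measurable
  have "integrable (M \<Otimes>\<^sub>M lborel) (case_prod ?g)"
  proof (rule Fubini_integrable)
    show "integrable M (\<lambda>\<xi>. \<integral>w. norm (case_prod ?g (\<xi>, w)) \<partial>lborel)"
    proof (rule Bochner_Integration.integrable_bound)
      show "integrable M (\<lambda>\<xi>. B \<xi> * c)" using B by simp
      have "(\<integral>w. norm (?g \<xi> w) \<partial>lborel) \<le> B \<xi> * c" if "\<xi> \<in> space M" for \<xi>
        unfolding c_def integral_mult_right_zero[symmetric]
        by (intro integral_mono integrable_norm section_integrable integrable_mult_right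
              integrable_laplace_kernel_quadratic that)
           (simp add: norm_mult bound mult_right_mono flip: mult.assoc)
      then show "AE \<xi> in M. norm (\<integral>w. norm (case_prod ?g (\<xi>, w)) \<partial>lborel) \<le> norm (B \<xi> * c)"
        by (intro AE_I2) (force intro: order_trans[OF _ abs_ge_self])
    qed measurable
    show "AE \<xi> in M. integrable lborel (\<lambda>w. case_prod ?g (\<xi>, w))"
      by (intro AE_I2) (simp add: section_integrable)
  qed measurable
  from integrable_snd[OF this] Fubini_integral[OF this]
  show "integrable lborel (\<lambda>w. (\<integral>\<xi>. f \<xi> w \<partial>M) * laplace_kernel w)"
    and "(\<integral>w. (\<integral>\<xi>. f \<xi> w \<partial>M) * laplace_kernel w \<partial>lborel)
        = (\<integral>\<xi>. (\<integral>w. f \<xi> w * laplace_kernel w \<partial>lborel) \<partial>M)"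
    by simp_all
qed

lemma laplace_kernel_integral_times_exp:
  assumes f: "f holomorphic_on {z. Re z \<le> 0}"
    and bound: "\<And>z. Re z \<le> 0 \<Longrightarrow> norm (f z) \<le> C * (1 + (norm z)\<^sup>2)" and s: "0 \<le> s"
  shows "(\<integral>w. f (\<i> * of_real w) * iexp (w * s) * laplace_kernel w \<partial>lborel)
      = f (-1) * of_real (exp (- s))"
proof -
  have "(\<integral>w. f (\<i> * of_real w) * exp (\<i> * of_real w * of_real s) * laplace_kernel w \<partial>lborel)
      = f (-1) * exp (-1 * of_real s)"
  proof (rule laplace_kernel_integral[where C = C])
    fix z :: complex assume z: "Re z \<le> 0"
    then have "norm (exp (z * of_real s)) \<le> 1" using s by (simp add: mult_nonpos_nonneg)
    then have "norm (f z) * norm (exp (z * of_real s)) \<le> norm (f z)"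
      by (intro mult_right_le_one_le) auto
    with bound[OF z] show "norm (f z * exp (z * of_real s)) \<le> C * (1 + (norm z)\<^sup>2)"
      unfolding norm_mult by linarith
  qed (intro holomorphic_intros f)
  then show ?thesis by (simp add: mult.assoc flip: exp_of_real)
qed

lemma laplace_kernel_integral_exp:
  assumes "0 \<le> s"
  shows "(\<integral>w. iexp (w * s) * laplace_kernel w \<partial>lborel) = of_real (exp (- s))"
  using laplace_kernel_integral_times_exp[of "\<lambda>_. 1" 1 s] assms by simp

lemma laplace_by_characteristic:
  assumes "finite_measure M" and [measurable]: "Y \<in> borel_measurable M" and Y: "AE \<xi> in M. 0 \<le> Y \<xi>"
  shows "complex_of_real (\<integral>\<xi>. exp (- Y \<xi>) \<partial>M)
     = (\<integral>w. (\<integral>\<xi>. iexp (w * Y \<xi>) \<partial>M) * laplace_kernel w \<partial>lborel)"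
proof -
  interpret finite_measure M by fact
  have "(\<integral>w. (\<integral>\<xi>. iexp (w * Y \<xi>) \<partial>M) * laplace_kernel w \<partial>lborel)
      = (\<integral>\<xi>. (\<integral>w. iexp (w * Y \<xi>) * laplace_kernel w \<partial>lborel) \<partial>M)"
    by (rule laplace_kernel_Fubini(2)[OF sigma_finite_measure_axioms, where B = "\<lambda>_. 1"]) auto
  also have "\<dots> = (\<integral>\<xi>. complex_of_real (exp (- Y \<xi>)) \<partial>M)"
  proof (rule integral_cong_AE)
    show "AE \<xi> in M. (\<integral>w. iexp (w * Y \<xi>) * laplace_kernel w \<partial>lborel)
        = complex_of_real (exp (- Y \<xi>))"
      using Y by eventually_elim (rule laplace_kernel_integral_exp)
  qed measurable
  finally show ?thesis by (simp only: integral_complex_of_real)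
qed

lemma integral_pair_measure_mult:
  fixes f :: "'a \<Rightarrow> 'c::{real_normed_field,banach,second_countable_topology}" and g :: "'b \<Rightarrow> 'c"
  assumes "sigma_finite_measure M" "sigma_finite_measure N" and f: "integrable M f"
    and g: "integrable N g"
  shows "(\<integral>(x, y). f x * g y \<partial>(M \<Otimes>\<^sub>M N)) = (\<integral>x. f x \<partial>M) * (\<integral>y. g y \<partial>N)"
proof -
  interpret pair_sigma_finite M N using assms by (simp add: pair_sigma_finite_def)
  have [measurable]: "f \<in> borel_measurable M" "g \<in> borel_measurable N" using f g by auto
  have "integrable (M \<Otimes>\<^sub>M N) (\<lambda>(x, y). f x * g y)"
    by (rule Fubini_integrable) (use f g in \<open>auto simp: norm_mult\<close>)
  from integral_fst'[OF this] show ?thesis by simp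
qed

lemma laplace_mult_by_characteristic:
  assumes "finite_measure M" "finite_measure N"
    and [measurable]: "Y \<in> borel_measurable M" "Z \<in> borel_measurable N"
    and Y: "AE \<xi> in M. 0 \<le> Y \<xi>" and Z: "AE \<eta> in N. 0 \<le> Z \<eta>"
  shows "complex_of_real ((\<integral>\<xi>. exp (- Y \<xi>) \<partial>M) * (\<integral>\<eta>. exp (- Z \<eta>) \<partial>N))
     = (\<integral>w. (\<integral>\<xi>. iexp (w * Y \<xi>) \<partial>M) * (\<integral>\<eta>. iexp (w * Z \<eta>) \<partial>N) * laplace_kernel w \<partial>lborel)"
proof -
  interpret M: finite_measure M by fact
  interpret N: finite_measure N by fact
  interpret pair_sigma_finite M N ..
  let ?S = "\<lambda>(\<xi>, \<eta>). Y \<xi> + Z \<eta>"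
  have product: "(\<integral>(\<xi>, \<eta>). f \<xi> * g \<eta> \<partial>(M \<Otimes>\<^sub>M N)) = (\<integral>\<xi>. f \<xi> \<partial>M) * (\<integral>\<eta>. g \<eta> \<partial>N)"
    if "integrable M f" "integrable N g"
    for f g :: "_ \<Rightarrow> 'z::{real_normed_field,banach,second_countable_topology}"
    using that by (intro integral_pair_measure_mult) unfold_locales
  have "complex_of_real (\<integral>z. exp (- ?S z) \<partial>(M \<Otimes>\<^sub>M N))
     = (\<integral>w. (\<integral>z. iexp (w * ?S z) \<partial>(M \<Otimes>\<^sub>M N)) * laplace_kernel w \<partial>lborel)"
  proof (rule laplace_by_characteristic)
    show "finite_measure (M \<Otimes>\<^sub>M N)" by (rule finite_measure_pair_measure) unfold_locales
    have "AE \<xi> in M. AE \<eta> in N. 0 \<le> ?S (\<xi>, \<eta>)"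
      using Y by eventually_elim (use Z in \<open>eventually_elim, simp\<close>)
    then show "AE z in M \<Otimes>\<^sub>M N. 0 \<le> ?S z" by (intro AE_pair_measure) auto
  qed measurable
  moreover have "(\<integral>z. exp (- ?S z) \<partial>(M \<Otimes>\<^sub>M N)) = (\<integral>\<xi>. exp (- Y \<xi>) \<partial>M) * (\<integral>\<eta>. exp (- Z \<eta>) \<partial>N)"
  proof -
    have "integrable M (\<lambda>\<xi>. exp (- Y \<xi>))" "integrable N (\<lambda>\<eta>. exp (- Z \<eta>))"
      using Y Z
      by (auto intro!: M.integrable_const_bound[where B = 1] N.integrable_const_bound[where B = 1])
    from product[OF this] show ?thesis
      by (simp add: case_prod_beta' exp_diff exp_minus divide_inverse)
  qed
  moreover have "(\<integral>z. iexp (w * ?S z) \<partial>(M \<Otimes>\<^sub>M N))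
      = (\<integral>\<xi>. iexp (w * Y \<xi>) \<partial>M) * (\<integral>\<eta>. iexp (w * Z \<eta>) \<partial>N)" for w
  proof -
    have "integrable M (\<lambda>\<xi>. iexp (w * Y \<xi>))" "integrable N (\<lambda>\<eta>. iexp (w * Z \<eta>))"
      by (auto intro!: M.integrable_const_bound[where B = 1] N.integrable_const_bound[where B = 1])
    from product[OF this] show ?thesis
      by (simp add: case_prod_beta' exp_add distrib_left)
  qed
  ultimately show ?thesis by (simp only:)
qed

section \<open>Levy-Khintchine exponents\<close>

definition pairing :: "complex^'d::finite \<Rightarrow> real^'d \<Rightarrow> complex" where
  "pairing u \<xi> = (\<Sum>k\<in>UNIV. u $ k * of_real (\<xi> $ k))"

definition cvec :: "real^'d \<Rightarrow> complex^'d" where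
  "cvec u = (\<chi> k. of_real (u $ k))"

lemma cvec_nth [simp]: "cvec u $ k = of_real (u $ k)"
  by (simp add: cvec_def)

lemma cvec_zero [simp]: "cvec 0 = 0"
  by (simp add: vec_eq_iff)

lemma pairing_cvec: "pairing (cvec u) \<xi> = of_real (u \<bullet> \<xi>)"
  by (simp add: pairing_def inner_vec_def)

lemma pairing_smult: "pairing (c *s u) \<xi> = c * pairing u \<xi>"
  by (simp add: pairing_def sum_distrib_left mult.assoc)

lemma pairing_add_right: "pairing u (\<xi> + \<eta>) = pairing u \<xi> + pairing u \<eta>"
  by (simp add: pairing_def sum.distrib distrib_left)

lemma pairing_zero_right [simp]: "pairing u 0 = 0"
  by (simp add: pairing_def)

lemma pairing_zero_left [simp]: "pairing 0 \<xi> = 0"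
  by (simp add: pairing_def)

lemma pairing_axis: "pairing u (axis k r) = u $ k * of_real r"
  by (simp add: pairing_def axis_def if_distrib[of "\<lambda>r. _ * complex_of_real r"] cong: if_cong)

lemma Re_pairing: "Re (pairing u \<xi>) = (\<chi> k. Re (u $ k)) \<bullet> \<xi>"
  by (simp add: pairing_def inner_vec_def)

lemma bounded_linear_pairing: "bounded_linear (\<lambda>u. pairing u \<xi>)"
  unfolding pairing_def
  by (intro bounded_linear_sum bounded_linear_mult_const bounded_linear_vec_nth)

lemma pairing_measurable [measurable]: "pairing u \<in> borel_measurable borel"
  unfolding pairing_def by measurable

lemma norm_pairing_le: "norm (pairing u \<xi>) \<le> norm u * norm \<xi>"
proof -
  have "norm (pairing u \<xi>) \<le> (\<Sum>k\<in>UNIV. \<bar>norm (u $ k)\<bar> * \<bar>norm (\<xi> $ k)\<bar>)"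
    unfolding pairing_def by (rule order_trans[OF norm_sum]) (simp add: norm_mult)
  also have "\<dots> \<le> norm u * norm \<xi>"
    unfolding norm_vec_def by (rule L2_set_mult_ineq)
  finally show ?thesis .
qed

lemma norm_smult_cvec: "norm (c *s cvec u) = norm c * norm u"
  by (simp add: norm_vec_def norm_mult L2_set_right_distrib)

lemma trunc_h_nth: "trunc_h \<xi> $ k = max (-1) (min 1 (\<xi> $ k))"
  by (auto simp: trunc_h_def min_def max_def)

lemma trunc_h_nth_measurable [measurable]: "(\<lambda>\<xi>. trunc_h \<xi> $ k) \<in> borel_measurable borel"
  unfolding trunc_h_nth by measurable

lemma trunc_h_measurable [measurable]: "trunc_h \<in> borel_measurable borel"
proof (rule borel_measurable_continuous_onI)
  have "continuous_on UNIV (\<lambda>\<xi>::real^'n. \<chi> k. max (-1) (min 1 (\<xi> $ k)))"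
    by (intro continuous_on_vec_lambda continuous_intros)
  also have "(\<lambda>\<xi>::real^'n. \<chi> k. max (-1) (min 1 (\<xi> $ k))) = trunc_h"
    by (simp add: fun_eq_iff vec_eq_iff trunc_h_nth)
  finally show "continuous_on UNIV (trunc_h :: real^'n \<Rightarrow> _)" .
qed

lemma trunc_h_eq_0_iff [simp]: "trunc_h \<xi> = 0 \<longleftrightarrow> \<xi> = 0"
proof -
  have "max (-1) (min 1 x) = 0 \<longleftrightarrow> x = 0" for x :: real by (auto simp: max_def min_def)
  then show ?thesis by (simp add: vec_eq_iff trunc_h_nth)
qed

lemma trunc_h_eq_self: "trunc_h \<xi> = \<xi>" if "\<And>k. \<bar>\<xi> $ k\<bar> \<le> 1"
  using that
  by (simp add: vec_eq_iff trunc_h_nth abs_le_iff max_def min_def)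
     (meson minus_le_iff order_antisym)

lemma one_le_norm_trunc_h: "1 \<le> norm (trunc_h \<xi>)" if "1 < \<bar>\<xi> $ k\<bar>"
proof -
  have "\<bar>trunc_h \<xi> $ k\<bar> = 1" using that by (auto simp: trunc_h_nth max_def min_def)
  then show ?thesis using component_le_norm_cart[of "trunc_h \<xi>" k] by simp
qed

lemma norm_exp_minus_one_minus_self_le:
  fixes z :: complex
  assumes "Re z \<le> 0"
  shows "norm (exp z - 1 - z) \<le> (norm z)\<^sup>2"
proof -
  have "norm (exp z - (\<Sum>i\<le>1. exp 0 * (z - 0) ^ i / fact i)) \<le> 1 * norm (z - 0) ^ Suc 1 / fact 1"
    by (rule complex_Taylor[of "{z. Re z \<le> 0}" 1 "\<lambda>_. exp" 1 0 z])
       (use assms in \<open>auto intro: convex_halfspace_Re_le has_field_derivative_at_within\<close>)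
  then show ?thesis by (simp add: diff_diff_eq power2_eq_square)
qed

lemma le_one_plus_square: "x \<le> 1 + x\<^sup>2" for x :: real
  using sum_squares_bound[of x 1] zero_le_power2[of x] by (cases "0 \<le> x") (simp, linarith)+

definition levy_integrand :: "complex^'d::finite \<Rightarrow> real^'d \<Rightarrow> complex" where
  "levy_integrand u \<xi> = exp (pairing u \<xi>) - 1 - pairing u (trunc_h \<xi>)"

definition real_levy_integrand :: "real^'d::finite \<Rightarrow> real^'d \<Rightarrow> real" where
  "real_levy_integrand u \<xi> = exp (u \<bullet> \<xi>) - 1 - u \<bullet> trunc_h \<xi>"

lemma levy_integrand_measurable [measurable]: "levy_integrand u \<in> borel_measurable borel"
  unfolding levy_integrand_def by measurable

lemma levy_integrand_cvec: "levy_integrand (cvec u) \<xi> = of_real (real_levy_integrand u \<xi>)"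
  by (simp add: levy_integrand_def real_levy_integrand_def pairing_cvec exp_of_real)

lemma norm_levy_integrand_le:
  assumes u: "Re (pairing u \<xi>) \<le> 0"
  shows "norm (levy_integrand u \<xi>) \<le> 3 * (1 + (norm u)\<^sup>2) * (norm (trunc_h \<xi>))\<^sup>2"
proof (cases "\<forall>k. \<bar>\<xi> $ k\<bar> \<le> 1")
  case True
  then have trunc: "trunc_h \<xi> = \<xi>" by (intro trunc_h_eq_self) simp
  have "norm (levy_integrand u \<xi>) \<le> (norm (pairing u \<xi>))\<^sup>2"
    unfolding levy_integrand_def trunc by (rule norm_exp_minus_one_minus_self_le[OF u])
  also have "\<dots> \<le> (norm u * norm \<xi>)\<^sup>2"
    by (intro power_mono norm_pairing_le) auto
  also have "\<dots> \<le> 3 * (1 + (norm u)\<^sup>2) * (norm \<xi>)\<^sup>2"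
    unfolding power_mult_distrib by (intro mult_right_mono) (auto simp: algebra_simps)
  finally show ?thesis by (simp add: trunc)
next
  case False
  let ?H = "norm (trunc_h \<xi>)" and ?U = "norm u"
  have one_le_H: "1 \<le> ?H" using False by (auto simp: not_le intro: one_le_norm_trunc_h)
  have "norm (levy_integrand u \<xi>) \<le> 1 + 1 + ?U * ?H"
    unfolding levy_integrand_def using u norm_pairing_le[of u "trunc_h \<xi>"]
    by (intro order_trans[OF norm_triangle_ineq4] add_mono) auto
  also have "\<dots> \<le> 2 * ?H\<^sup>2 + (1 + ?U\<^sup>2) * ?H\<^sup>2"
  proof -
    have "?U \<le> 1 + ?U\<^sup>2" by (rule le_one_plus_square)
    moreover have "?H \<le> ?H\<^sup>2" using mult_left_mono[OF one_le_H, of ?H]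
      by (simp add: power2_eq_square)
    moreover have "1 \<le> ?H\<^sup>2" using one_le_H by (simp add: one_le_power)
    ultimately show ?thesis by (intro add_mono mult_mono) auto
  qed
  also have "\<dots> \<le> 3 * (1 + ?U\<^sup>2) * ?H\<^sup>2" by (simp add: algebra_simps)
  finally show ?thesis .
qed

definition quadratic_form :: "real^'d^'d \<Rightarrow> complex^'d::finite \<Rightarrow> complex" where
  "quadratic_form A u = (\<Sum>k\<in>UNIV. \<Sum>l\<in>UNIV. of_real (A $ k $ l) * u $ l * u $ k)"

lemma inner_matrix_vector_mult: "x \<bullet> (A *v y) = (\<Sum>k\<in>UNIV. \<Sum>l\<in>UNIV. A $ k $ l * y $ l * x $ k)"
  for x :: "real^'m::finite"
  by (simp add: inner_vec_def matrix_vector_mult_def sum_distrib_left mult_ac)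

lemma quadratic_form_cvec: "quadratic_form A (cvec u) = of_real (u \<bullet> (A *v u))"
  by (simp add: quadratic_form_def inner_matrix_vector_mult)

lemma quadratic_form_smult: "quadratic_form A (c *s u) = c\<^sup>2 * quadratic_form A u"
  by (simp add: quadratic_form_def sum_distrib_left power2_eq_square mult_ac)

lemma norm_quadratic_form_le:
  "norm (quadratic_form A u) \<le> (\<Sum>k\<in>UNIV. \<Sum>l\<in>UNIV. \<bar>A $ k $ l\<bar>) * (norm u)\<^sup>2"
  unfolding quadratic_form_def sum_distrib_right
proof (intro sum_norm_le)
  fix k l
  have "norm (u $ l) * norm (u $ k) \<le> norm u * norm u"
    by (intro mult_mono Finite_Cartesian_Product.norm_nth_le) auto
  then show "norm (of_real (A $ k $ l) * u $ l * u $ k) \<le> \<bar>A $ k $ l\<bar> * (norm u)\<^sup>2"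
    by (simp add: norm_mult mult.assoc mult_left_mono power2_eq_square)
qed

lemma convex_on_quadratic_form:
  fixes A :: "real^'d^'d::finite"
  assumes "convex S" and A: "\<And>y. 0 \<le> y \<bullet> (A *v y)"
  shows "convex_on S (\<lambda>u. u \<bullet> (A *v u))"
proof (rule convex_onI)
  fix t :: real and u v :: "real^'d" assume t: "0 < t" "t < 1"
  let ?w = "(1 - t) *\<^sub>R u + t *\<^sub>R v"
  have "0 \<le> t * (1 - t) * ((u - v) \<bullet> (A *v (u - v)))" using t A by simp
  also have "\<dots> = (1 - t) * (u \<bullet> (A *v u)) + t * (v \<bullet> (A *v v)) - ?w \<bullet> (A *v ?w)"
    by (simp add: matrix_vector_right_distrib matrix_vector_mult_diff_distrib
        matrix_vector_mult_scaleR inner_add_left inner_add_right inner_diff_left inner_diff_right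
        algebra_simps)
  finally show "?w \<bullet> (A *v ?w) \<le> (1 - t) * (u \<bullet> (A *v u)) + t * (v \<bullet> (A *v v))" by simp
qed (rule assms(1))

definition levy_exponent ::
  "real^'d^'d \<Rightarrow> real^'d \<Rightarrow> real \<Rightarrow> (real^'d::finite) measure \<Rightarrow> complex^'d \<Rightarrow> complex" where
  "levy_exponent A b c \<nu> u =
     (1/2) * quadratic_form A u + pairing u b - of_real c + (\<integral>\<xi>. levy_integrand u \<xi> \<partial>\<nu>)"

definition real_levy_exponent ::
  "real^'d^'d \<Rightarrow> real^'d \<Rightarrow> real \<Rightarrow> (real^'d::finite) measure \<Rightarrow> real^'d \<Rightarrow> real" where
  "real_levy_exponent A b c \<nu> u =
     (1/2) * (u \<bullet> (A *v u)) + u \<bullet> b - c + (\<integral>\<xi>. real_levy_integrand u \<xi> \<partial>\<nu>)"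

lemma levy_exponent_cvec: "levy_exponent A b c \<nu> (cvec u) = of_real (real_levy_exponent A b c \<nu> u)"
  by (simp add: levy_exponent_def real_levy_exponent_def quadratic_form_cvec pairing_cvec
      levy_integrand_cvec)

lemma Rfun_eq_levy_exponent:
  "Rfun alpha beta gamma kappa j = levy_exponent (alpha j) (beta j) (gamma j) (kappa j)"
  by (simp add: fun_eq_iff Rfun_def levy_exponent_def quadratic_form_def levy_integrand_def
      pairing_def mult.commute)

lemma levy_integrand_ray:
  "levy_integrand (z *s cvec a) \<xi> = exp (z * of_real (a \<bullet> \<xi>)) - 1 - z * of_real (a \<bullet> trunc_h \<xi>)"
  by (simp add: levy_integrand_def pairing_smult pairing_cvec)

lemma levy_integrand_minus_cvec:
  "levy_integrand (- cvec a) \<xi> = of_real (real_levy_integrand (- a) \<xi>)"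
  using levy_integrand_ray[of "-1" a \<xi>] by (simp add: real_levy_integrand_def flip: exp_of_real)

lemma norm_levy_integrand_ray_le:
  assumes "Re z * (a \<bullet> \<xi>) \<le> 0"
  shows "norm (levy_integrand (z *s cvec a) \<xi>)
      \<le> 3 * (1 + (norm a)\<^sup>2) * (norm (trunc_h \<xi>))\<^sup>2 * (1 + (norm z)\<^sup>2)"
proof -
  have "norm (levy_integrand (z *s cvec a) \<xi>)
      \<le> 3 * (1 + (norm (z *s cvec a))\<^sup>2) * (norm (trunc_h \<xi>))\<^sup>2"
    by (rule norm_levy_integrand_le) (simp add: pairing_smult pairing_cvec assms)
  also have "\<dots> \<le> 3 * ((1 + (norm a)\<^sup>2) * (1 + (norm z)\<^sup>2)) * (norm (trunc_h \<xi>))\<^sup>2"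
    unfolding norm_smult_cvec
    by (intro mult_right_mono mult_left_mono) (auto simp: power_mult_distrib algebra_simps)
  finally show ?thesis by (simp only: mult_ac)
qed

locale levy_measure =
  fixes \<nu> :: "(real^'d::finite) measure"
  assumes sets_eq_borel [measurable_cong, simp]: "sets \<nu> = sets borel"
    and emeasure_0: "emeasure \<nu> {0} = 0"
    and integrable_trunc_h_square: "integrable \<nu> (\<lambda>\<xi>. (norm (trunc_h \<xi>))\<^sup>2)"
begin

lemma space_eq_UNIV [simp]: "space \<nu> = UNIV"
  using sets_eq_imp_space_eq[OF sets_eq_borel] by simp

lemma sigma_finite: "sigma_finite_measure \<nu>"
proof
  define A where "A n = {\<xi> \<in> space \<nu>. 1 / real (Suc n) \<le> (norm (trunc_h \<xi>))\<^sup>2}" for n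
  have "\<exists>n. \<xi> \<in> A n" if "\<xi> \<noteq> 0" for \<xi>
    using reals_Archimedean[of "(norm (trunc_h \<xi>))\<^sup>2"] that
    by (auto simp: A_def inverse_eq_divide intro: less_imp_le)
  then have "\<Union>(insert {0} (range A)) = space \<nu>" by (simp add: set_eq_iff) blast
  moreover have "emeasure \<nu> (A n) < \<infinity>" for n
    using integral_Markov_inequality[OF integrable_trunc_h_square, of "1 / real (Suc n)"]
    unfolding A_def by (rule le_less_trans) auto
  moreover have "A n \<in> sets \<nu>" for n unfolding A_def by measurable
  ultimately show "\<exists>\<A>. countable \<A> \<and> \<A> \<subseteq> sets \<nu> \<and> \<Union>\<A> = space \<nu> \<and> (\<forall>a\<in>\<A>. emeasure \<nu> a \<noteq> \<infinity>)"
    by (intro exI[of _ "insert {0} (range A)"]) (auto simp: emeasure_0 less_top)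
qed

lemma integrable_levy_integrand:
  assumes "AE \<xi> in \<nu>. Re (pairing u \<xi>) \<le> 0"
  shows "integrable \<nu> (levy_integrand u)"
proof (rule Bochner_Integration.integrable_bound)
  show "integrable \<nu> (\<lambda>\<xi>. 3 * (1 + (norm u)\<^sup>2) * (norm (trunc_h \<xi>))\<^sup>2)"
    by (intro integrable_mult_right integrable_trunc_h_square)
  show "AE \<xi> in \<nu>. norm (levy_integrand u \<xi>) \<le> norm (3 * (1 + (norm u)\<^sup>2) * (norm (trunc_h \<xi>))\<^sup>2)"
    using assms by eventually_elim (use norm_levy_integrand_le in simp)
qed measurable

lemma integrable_real_levy_integrand:
  assumes "AE \<xi> in \<nu>. u \<bullet> \<xi> \<le> 0"
  shows "integrable \<nu> (real_levy_integrand u)"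
  using integrable_Re[OF integrable_levy_integrand[of "cvec u"]] assms
  by (simp add: pairing_cvec levy_integrand_cvec)

lemma levy_exponent_quadratic_growth:
  obtains C where "0 \<le> C"
    "\<And>u. AE \<xi> in \<nu>. Re (pairing u \<xi>) \<le> 0 \<Longrightarrow> norm (levy_exponent A b c \<nu> u) \<le> C * (1 + (norm u)\<^sup>2)"
proof -
  define m where "m = (\<integral>\<xi>. (norm (trunc_h \<xi>))\<^sup>2 \<partial>\<nu>)"
  define C where "C = (\<Sum>k\<in>UNIV. \<Sum>l\<in>UNIV. \<bar>A $ k $ l\<bar>) + norm b + \<bar>c\<bar> + 3 * m"
  have "norm (levy_exponent A b c \<nu> u) \<le> C * (1 + (norm u)\<^sup>2)"
    if u: "AE \<xi> in \<nu>. Re (pairing u \<xi>) \<le> 0" for u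
  proof -
    let ?U = "1 + (norm u)\<^sup>2"
    have "norm ((1/2) * quadratic_form A u) \<le> norm (quadratic_form A u)" by (simp add: norm_mult)
    also have "\<dots> \<le> (\<Sum>k\<in>UNIV. \<Sum>l\<in>UNIV. \<bar>A $ k $ l\<bar>) * ?U"
      by (rule order_trans[OF norm_quadratic_form_le]) (auto intro!: mult_left_mono sum_nonneg)
    finally have diffusion: "norm ((1/2) * quadratic_form A u)
        \<le> (\<Sum>k\<in>UNIV. \<Sum>l\<in>UNIV. \<bar>A $ k $ l\<bar>) * ?U" .
    have drift: "norm (pairing u b) \<le> norm b * ?U"
      using norm_pairing_le[of u b] mult_left_mono[OF le_one_plus_square, of "norm b" "norm u"]
      by (simp add: mult.commute)
    have killing: "norm (complex_of_real c) \<le> \<bar>c\<bar> * ?U" by (simp add: distrib_left)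
    have "norm (\<integral>\<xi>. levy_integrand u \<xi> \<partial>\<nu>) \<le> (\<integral>\<xi>. 3 * ?U * (norm (trunc_h \<xi>))\<^sup>2 \<partial>\<nu>)"
    proof (intro order_trans[OF integral_norm_bound] integral_mono_AE)
      show "AE \<xi> in \<nu>. norm (levy_integrand u \<xi>) \<le> 3 * ?U * (norm (trunc_h \<xi>))\<^sup>2"
        using u by eventually_elim (rule norm_levy_integrand_le)
    qed (intro integrable_norm integrable_levy_integrand integrable_mult_right
        integrable_trunc_h_square u)+
    then have jumps: "norm (\<integral>\<xi>. levy_integrand u \<xi> \<partial>\<nu>) \<le> 3 * m * ?U"
      by (simp only: integral_mult_right_zero m_def) (simp only: mult_ac)
    show ?thesis
      unfolding levy_exponent_def C_def distrib_right[of _ _ ?U]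
      by (intro norm_triangle_mono order_trans[OF norm_triangle_ineq4] add_mono diffusion drift
          killing jumps)
  qed
  moreover have "0 \<le> C" unfolding C_def m_def by (intro add_nonneg_nonneg sum_nonneg) auto
  ultimately show thesis using that by blast
qed

lemma convex_on_real_levy_exponent:
  assumes S: "convex S" "\<And>u. u \<in> S \<Longrightarrow> AE \<xi> in \<nu>. u \<bullet> \<xi> \<le> 0" and A: "\<And>y. 0 \<le> y \<bullet> (A *v y)"
  shows "convex_on S (real_levy_exponent A b c \<nu>)"
proof -
  have "convex_on S (\<lambda>u. \<integral>\<xi>. real_levy_integrand u \<xi> \<partial>\<nu>)"
  proof (rule convex_onI)
    fix t :: real and u v assume t: "0 < t" "t < 1" and uv: "u \<in> S" "v \<in> S"
    let ?w = "(1 - t) *\<^sub>R u + t *\<^sub>R v"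
    have w: "?w \<in> S" using convexD[OF S(1) uv, of "1 - t" t] t by simp
    note integrable = integrable_real_levy_integrand[OF S(2)]
    have "(\<integral>\<xi>. real_levy_integrand ?w \<xi> \<partial>\<nu>)
        \<le> (\<integral>\<xi>. (1 - t) * real_levy_integrand u \<xi> + t * real_levy_integrand v \<xi> \<partial>\<nu>)"
    proof (rule integral_mono)
      fix \<xi>
      have "exp ((1 - t) *\<^sub>R (u \<bullet> \<xi>) + t *\<^sub>R (v \<bullet> \<xi>)) \<le> (1 - t) * exp (u \<bullet> \<xi>) + t * exp (v \<bullet> \<xi>)"
        using t by (intro convex_onD[OF exp_convex]) auto
      then show "real_levy_integrand ?w \<xi>
          \<le> (1 - t) * real_levy_integrand u \<xi> + t * real_levy_integrand v \<xi>"
        by (simp add: real_levy_integrand_def inner_add_left algebra_simps)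
    qed (use integrable[OF w] integrable[OF uv(1)] integrable[OF uv(2)] in auto)
    then show "(\<integral>\<xi>. real_levy_integrand ?w \<xi> \<partial>\<nu>)
        \<le> (1 - t) * (\<integral>\<xi>. real_levy_integrand u \<xi> \<partial>\<nu>) + t * (\<integral>\<xi>. real_levy_integrand v \<xi> \<partial>\<nu>)"
      using integrable[OF uv(1)] integrable[OF uv(2)] by simp
  qed (rule S(1))
  moreover have "convex_on S (\<lambda>u. u \<bullet> b - c)"
    by (rule convex_onI[OF _ S(1)]) (simp add: inner_add_left algebra_simps)
  ultimately have "convex_on S (\<lambda>u. (1/2) * (u \<bullet> (A *v u)) + (u \<bullet> b - c)
      + (\<integral>\<xi>. real_levy_integrand u \<xi> \<partial>\<nu>))"
    using S(1) A by (intro convex_on_add convex_on_cmul convex_on_quadratic_form) auto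
  then show ?thesis by (simp add: real_levy_exponent_def[abs_def] add_diff_eq)
qed

lemma
  assumes s: "0 \<le> s" and a: "AE \<xi> in \<nu>. 0 \<le> a \<bullet> \<xi>"
  defines "jumps w \<equiv> (\<integral>\<xi>. levy_integrand ((\<i> * of_real w) *s cvec a) \<xi> \<partial>\<nu>)
      * iexp (w * s) * laplace_kernel w"
  shows integrable_laplace_kernel_jumps: "integrable lborel jumps"
    and integral_laplace_kernel_jumps:
      "(\<integral>w. jumps w \<partial>lborel) = of_real ((\<integral>\<xi>. real_levy_integrand (- a) \<xi> \<partial>\<nu>) * exp (- s))"
proof -
  let ?f = "\<lambda>\<xi> w. levy_integrand ((\<i> * of_real w) *s cvec a) \<xi> * iexp (w * s)"
  have jumps: "jumps w = (\<integral>\<xi>. ?f \<xi> w \<partial>\<nu>) * laplace_kernel w" for w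
    by (simp add: jumps_def)
  have measurable: "case_prod ?f \<in> borel_measurable (\<nu> \<Otimes>\<^sub>M borel)"
    unfolding levy_integrand_ray by measurable
  have B: "integrable \<nu> (\<lambda>\<xi>. 3 * (1 + (norm a)\<^sup>2) * (norm (trunc_h \<xi>))\<^sup>2)"
    by (intro integrable_mult_right integrable_trunc_h_square)
  have bound: "norm (?f \<xi> w) \<le> 3 * (1 + (norm a)\<^sup>2) * (norm (trunc_h \<xi>))\<^sup>2 * (1 + w\<^sup>2)" for \<xi> w
    using norm_levy_integrand_ray_le[of "\<i> * of_real w" a \<xi>] by (simp add: norm_mult)
  note Fubini = laplace_kernel_Fubini[OF sigma_finite measurable B bound]
  show "integrable lborel jumps" using Fubini(1) by (simp add: jumps[abs_def])
  have "(\<integral>w. jumps w \<partial>lborel) = (\<integral>\<xi>. (\<integral>w. ?f \<xi> w * laplace_kernel w \<partial>lborel) \<partial>\<nu>)"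
    unfolding jumps by (rule Fubini(2))
  also have "\<dots> = (\<integral>\<xi>. complex_of_real (real_levy_integrand (- a) \<xi> * exp (- s)) \<partial>\<nu>)"
  proof (rule integral_cong_AE)
    show "AE \<xi> in \<nu>. (\<integral>w. ?f \<xi> w * laplace_kernel w \<partial>lborel)
        = of_real (real_levy_integrand (- a) \<xi> * exp (- s))"
      using a
    proof eventually_elim
      case (elim \<xi>)
      have "(\<lambda>z. levy_integrand (z *s cvec a) \<xi>) holomorphic_on {z. Re z \<le> 0}"
        unfolding levy_integrand_ray by (intro holomorphic_intros)
      then have "(\<integral>w. ?f \<xi> w * laplace_kernel w \<partial>lborel)
          = levy_integrand ((-1) *s cvec a) \<xi> * of_real (exp (- s))"
        by (rule laplace_kernel_integral_times_exp[OF _ norm_levy_integrand_ray_le s])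
           (simp add: elim mult_nonpos_nonneg)
      then show ?case by (simp add: levy_integrand_minus_cvec)
    qed
    show "(\<lambda>\<xi>. \<integral>w. ?f \<xi> w * laplace_kernel w \<partial>lborel) \<in> borel_measurable \<nu>"
      unfolding levy_integrand_ray by measurable
    show "(\<lambda>\<xi>. complex_of_real (real_levy_integrand (- a) \<xi> * exp (- s))) \<in> borel_measurable \<nu>"
      unfolding real_levy_integrand_def by measurable
  qed
  finally show "(\<integral>w. jumps w \<partial>lborel) = of_real ((\<integral>\<xi>. real_levy_integrand (- a) \<xi> \<partial>\<nu>) * exp (- s))"
    by (simp only: integral_complex_of_real integral_mult_left_zero)
qed

lemma
  fixes A :: "real^'d^'d" and a b :: "real^'d" and c :: real
  assumes s: "0 \<le> s" and a: "AE \<xi> in \<nu>. 0 \<le> a \<bullet> \<xi>"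
  defines "f w \<equiv> levy_exponent A b c \<nu> ((\<i> * of_real w) *s cvec a)
      * iexp (w * s) * laplace_kernel w"
  shows integrable_laplace_kernel_levy_exponent: "integrable lborel f"
    and integral_laplace_kernel_levy_exponent:
      "(\<integral>w. f w \<partial>lborel) = of_real (real_levy_exponent A b c \<nu> (- a) * exp (- s))"
proof -
  define q where "q z = (1/2) * (z\<^sup>2 * of_real (a \<bullet> (A *v a))) + z * of_real (a \<bullet> b) - of_real c"
    for z :: complex
  let ?gauss = "\<lambda>w. q (\<i> * of_real w) * iexp (w * s) * laplace_kernel w"
  let ?jumps = "\<lambda>w. (\<integral>\<xi>. levy_integrand ((\<i> * of_real w) *s cvec a) \<xi> \<partial>\<nu>)
      * iexp (w * s) * laplace_kernel w"
  have split: "f w = ?gauss w + ?jumps w" for w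
    by (simp add: f_def q_def levy_exponent_def quadratic_form_smult quadratic_form_cvec
        pairing_smult pairing_cvec distrib_right)
  have q_bound: "norm (q z) \<le> (\<bar>a \<bullet> (A *v a)\<bar> + \<bar>a \<bullet> b\<bar> + \<bar>c\<bar>) * (1 + (norm z)\<^sup>2)" for z
  proof -
    have "norm (q z) \<le> \<bar>a \<bullet> (A *v a)\<bar> * (norm z)\<^sup>2 + \<bar>a \<bullet> b\<bar> * norm z + \<bar>c\<bar> * 1"
      unfolding q_def
      by (intro norm_triangle_mono order_trans[OF norm_triangle_ineq4] add_mono)
         (auto simp: norm_mult norm_power)
    also have "\<dots> \<le> (\<bar>a \<bullet> (A *v a)\<bar> + \<bar>a \<bullet> b\<bar> + \<bar>c\<bar>) * (1 + (norm z)\<^sup>2)"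
      unfolding distrib_right using le_one_plus_square[of "norm z"]
      by (intro add_mono mult_left_mono) auto
    finally show ?thesis .
  qed
  have integrable_gauss: "integrable lborel ?gauss"
    using q_bound[of "\<i> * of_real _"]
    by (intro integrable_times_exp_laplace_kernel) (auto simp: q_def norm_mult)
  note integrable_jumps = integrable_laplace_kernel_jumps[OF s a]
  show "integrable lborel f"
    unfolding split[abs_def]
    by (intro Bochner_Integration.integrable_add integrable_gauss integrable_jumps)
  have "(\<integral>w. f w \<partial>lborel) = (\<integral>w. ?gauss w \<partial>lborel) + (\<integral>w. ?jumps w \<partial>lborel)"
    unfolding split by (rule Bochner_Integration.integral_add[OF integrable_gauss integrable_jumps])
  also have "(\<integral>w. ?gauss w \<partial>lborel) = q (-1) * of_real (exp (- s))"
    using q_bound s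
    by (rule laplace_kernel_integral_times_exp[rotated]) (unfold q_def, intro holomorphic_intros)
  also have "(\<integral>w. ?jumps w \<partial>lborel) = of_real ((\<integral>\<xi>. real_levy_integrand (- a) \<xi> \<partial>\<nu>) * exp (- s))"
    by (rule integral_laplace_kernel_jumps[OF s a])
  finally show "(\<integral>w. f w \<partial>lborel) = of_real (real_levy_exponent A b c \<nu> (- a) * exp (- s))"
    by (simp add: q_def real_levy_exponent_def linear_neg[OF matrix_vector_mul_linear]
        algebra_simps)
qed

end

section \<open>The functional characteristics of an affine process\<close>

definition neg_cone :: "'d::finite set \<Rightarrow> (real^'d) set" where
  "neg_cone I = {u. (\<forall>k\<in>I. u $ k \<le> 0) \<and> (\<forall>k. k \<notin> I \<longrightarrow> u $ k = 0)}"

definition left_cone :: "'d::finite set \<Rightarrow> (complex^'d) set" where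
  "left_cone I = {u. (\<chi> k. Re (u $ k)) \<in> neg_cone I}"

lemma zero_in_neg_cone [simp]: "0 \<in> neg_cone I"
  by (simp add: neg_cone_def)

lemma scaleR_in_neg_cone: "0 \<le> c \<Longrightarrow> u \<in> neg_cone I \<Longrightarrow> c *\<^sub>R u \<in> neg_cone I"
  by (auto simp: neg_cone_def mult_nonneg_nonpos)

lemma convex_neg_cone: "convex (neg_cone I)"
  by (rule convexI) (auto simp: neg_cone_def add_nonpos_nonpos mult_nonneg_nonpos)

lemma inner_neg_cone_stateD_nonpos: "u \<in> neg_cone I \<Longrightarrow> \<xi> \<in> stateD I \<Longrightarrow> u \<bullet> \<xi> \<le> 0"
  unfolding inner_vec_def
proof (rule sum_nonpos)
  fix k assume "u \<in> neg_cone I" "\<xi> \<in> stateD I"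
  then show "u $ k \<bullet> \<xi> $ k \<le> 0"
    by (cases "k \<in> I") (auto simp: neg_cone_def stateD_def mult_nonpos_nonneg)
qed

lemma Re_pairing_left_cone_nonpos: "u \<in> left_cone I \<Longrightarrow> \<xi> \<in> stateD I \<Longrightarrow> Re (pairing u \<xi>) \<le> 0"
  by (simp add: Re_pairing left_cone_def inner_neg_cone_stateD_nonpos)

lemma zero_in_stateD [simp]: "0 \<in> stateD I"
  by (simp add: stateD_def)

lemma axis_in_stateD: "0 \<le> r \<or> k \<notin> I \<Longrightarrow> axis k r \<in> stateD I"
  by (auto simp: stateD_def axis_def)

lemma add_in_stateD: "x \<in> stateD I \<Longrightarrow> y \<in> stateD I \<Longrightarrow> x + y \<in> stateD I"
  by (simp add: stateD_def)

lemma neg_cone_eq_0: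
  assumes u: "u \<in> neg_cone I" and inner: "\<And>x. x \<in> stateD I \<Longrightarrow> 0 \<le> u \<bullet> x"
  shows "u = 0"
proof -
  have "0 \<le> u $ k" for k using inner[of "axis k 1"] by (simp add: axis_in_stateD inner_axis)
  then show ?thesis using u by (auto simp: neg_cone_def vec_eq_iff intro: antisym)
qed

lemma stateD_measurable [measurable]: "stateD I \<in> sets borel"
proof -
  have "stateD I = (\<Inter>i\<in>I. {x. 0 \<le> x $ i})" by (auto simp: stateD_def)
  also have "closed \<dots>"
    by (intro closed_INT ballI closed_Collect_le continuous_intros)
  finally show ?thesis by (rule borel_closed)
qed

locale affine_parameters =
  fixes I :: "'d::finite set"
    and alpha :: "'d option \<Rightarrow> real^'d^'d" and beta :: "'d option \<Rightarrow> real^'d"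
    and gamma :: "'d option \<Rightarrow> real" and kappa :: "'d option \<Rightarrow> (real^'d) measure"
  assumes adm: "admissible I alpha beta gamma kappa"
begin

abbreviation "R \<equiv> Rfun alpha beta gamma kappa"

definition real_R :: "'d option \<Rightarrow> real^'d \<Rightarrow> real" where
  "real_R j = real_levy_exponent (alpha j) (beta j) (gamma j) (kappa j)"

definition riccati :: "complex^'d \<Rightarrow> complex^'d" where
  "riccati u = (\<chi> k. R (Some k) u)"

text \<open>The generator maps \<open>exp \<langle>u, \<cdot>\<rangle>\<close> to \<open>symbol x u * exp \<langle>u, x\<rangle>\<close>.\<close>

definition symbol :: "real^'d \<Rightarrow> complex^'d \<Rightarrow> complex" where
  "symbol x u = R None u + pairing (riccati u) x"

definition real_symbol :: "real^'d \<Rightarrow> real^'d \<Rightarrow> real" where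
  "real_symbol x u = real_R None u + (\<Sum>k\<in>UNIV. real_R (Some k) u * x $ k)"

lemma R_cvec: "R j (cvec u) = of_real (real_R j u)"
  by (simp add: Rfun_eq_levy_exponent real_R_def levy_exponent_cvec)

lemma AE_kappa: "AE \<xi> in kappa j. \<xi> \<in> stateD I"
proof (rule AE_I)
  show "emeasure (kappa j) (UNIV - (stateD I - {0})) = 0" "UNIV - (stateD I - {0}) \<in> sets (kappa j)"
    using adm by (simp_all add: admissible_def)
qed auto

sublocale kappa: levy_measure "kappa j" for j
proof
  show sets: "sets (kappa j) = sets borel" using adm by (simp add: admissible_def)
  have "emeasure (kappa j) {0} \<le> emeasure (kappa j) (UNIV - (stateD I - {0}))"
    by (rule emeasure_mono) (auto simp: sets)
  then show "emeasure (kappa j) {0} = 0" using adm by (simp add: admissible_def)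
  have "(\<integral>\<^sup>+ \<xi>. ennreal ((norm (trunc_h \<xi>))\<^sup>2) \<partial>kappa j) < \<infinity>"
  proof (cases "\<exists>i. j = Some i \<and> i \<notin> I")
    case True
    then have "\<forall>A. emeasure (kappa j) A = 0" using adm by (auto simp: admissible_def)
    then have "kappa j = null_measure (kappa j)" by (intro measure_eqI) auto
    then have "(\<integral>\<^sup>+ \<xi>. ennreal ((norm (trunc_h \<xi>))\<^sup>2) \<partial>kappa j) = 0"
      by (metis nn_integral_null_measure)
    then show ?thesis by simp
  next
    case False
    then have "j = None \<or> (\<exists>i\<in>I. j = Some i)" by (cases j) auto
    then show ?thesis using adm unfolding admissible_def by blast
  qed
  then show "integrable (kappa j) (\<lambda>\<xi>. (norm (trunc_h \<xi>))\<^sup>2)"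
    by (intro integrableI_nonneg) (auto simp: measurable_cong_sets[OF sets])
qed

lemma AE_inner_nonpos: "u \<in> neg_cone I \<Longrightarrow> AE \<xi> in kappa j. u \<bullet> \<xi> \<le> 0"
  using AE_kappa[of j] by eventually_elim (rule inner_neg_cone_stateD_nonpos)

lemma convex_on_real_R: "convex_on (neg_cone I) (real_R j)"
  unfolding real_R_def
  by (rule kappa.convex_on_real_levy_exponent[OF convex_neg_cone AE_inner_nonpos])
     (use adm in \<open>auto simp: admissible_def\<close>)

lemma R_quadratic_growth:
  obtains C where "0 \<le> C" "\<And>j u. u \<in> left_cone I \<Longrightarrow> norm (R j u) \<le> C * (1 + (norm u)\<^sup>2)"
proof -
  have "\<exists>C\<ge>0. \<forall>u\<in>left_cone I. norm (R j u) \<le> C * (1 + (norm u)\<^sup>2)" for j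
  proof -
    have "AE \<xi> in kappa j. Re (pairing u \<xi>) \<le> 0" if "u \<in> left_cone I" for u
      using AE_kappa[of j] by eventually_elim (rule Re_pairing_left_cone_nonpos[OF that])
    then show ?thesis
      using kappa.levy_exponent_quadratic_growth[of j "alpha j" "beta j" "gamma j"]
      unfolding Rfun_eq_levy_exponent by metis
  qed
  then obtain C where C: "\<And>j. 0 \<le> C j"
    "\<And>j u. u \<in> left_cone I \<Longrightarrow> norm (R j u) \<le> C j * (1 + (norm u)\<^sup>2)" by metis
  have "C j * (1 + (norm u)\<^sup>2) \<le> sum C UNIV * (1 + (norm u)\<^sup>2)" for j and u :: "complex^'d"
    using C(1) by (intro mult_right_mono member_le_sum) auto
  then show thesis
    using that[of "sum C UNIV"] C by (meson order_trans sum_nonneg)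
qed

lemma riccati_quadratic_growth:
  obtains C where "0 \<le> C" "\<And>u. u \<in> left_cone I \<Longrightarrow> norm (riccati u) \<le> C * (1 + (norm u)\<^sup>2)"
proof -
  obtain C where C: "0 \<le> C" "\<And>j u. u \<in> left_cone I \<Longrightarrow> norm (R j u) \<le> C * (1 + (norm u)\<^sup>2)"
    using R_quadratic_growth by blast
  have "norm (riccati u) \<le> (real CARD('d) * C) * (1 + (norm u)\<^sup>2)" if "u \<in> left_cone I" for u
  proof -
    have "norm (riccati u) \<le> (\<Sum>k\<in>UNIV. norm (riccati u $ k))"
      unfolding norm_vec_def by (rule L2_set_le_sum) simp
    also have "\<dots> \<le> (\<Sum>k\<in>(UNIV :: 'd set). C * (1 + (norm u)\<^sup>2))"
      by (rule sum_mono) (simp add: riccati_def C(2)[OF that])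
    finally show ?thesis by simp
  qed
  with C(1) that[of "real CARD('d) * C"] show thesis by simp
qed

lemma symbol_quadratic_growth:
  obtains C where "0 \<le> C" "\<And>u. u \<in> left_cone I \<Longrightarrow> norm (symbol x u) \<le> C * (1 + (norm u)\<^sup>2)"
proof -
  obtain B where B: "0 \<le> B" "\<And>j u. u \<in> left_cone I \<Longrightarrow> norm (R j u) \<le> B * (1 + (norm u)\<^sup>2)"
    using R_quadratic_growth by blast
  obtain C where C: "0 \<le> C" "\<And>u. u \<in> left_cone I \<Longrightarrow> norm (riccati u) \<le> C * (1 + (norm u)\<^sup>2)"
    using riccati_quadratic_growth by blast
  have "norm (symbol x u) \<le> (B + C * norm x) * (1 + (norm u)\<^sup>2)" if u: "u \<in> left_cone I" for u
  proof -
    have "norm (symbol x u) \<le> norm (R None u) + norm (riccati u) * norm x"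
      unfolding symbol_def by (intro norm_triangle_mono norm_pairing_le) auto
    also have "\<dots> \<le> B * (1 + (norm u)\<^sup>2) + C * (1 + (norm u)\<^sup>2) * norm x"
      by (intro add_mono mult_right_mono B C u) auto
    finally show ?thesis by (simp add: algebra_simps)
  qed
  with B(1) C(1) that[of "B + C * norm x"] show thesis by simp
qed

lemma integral_laplace_kernel_symbol:
  assumes s: "0 \<le> s" and u: "u \<in> neg_cone I"
  shows "(\<integral>w. symbol x ((\<i> * of_real w) *s cvec (- u)) * iexp (w * s) * laplace_kernel w \<partial>lborel)
    = of_real (real_symbol x u * exp (- s))"
proof -
  define g where
    "g j w = R j ((\<i> * of_real w) *s cvec (- u)) * iexp (w * s) * laplace_kernel w" for j w
  have "AE \<xi> in kappa j. 0 \<le> - u \<bullet> \<xi>" for j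
    using AE_inner_nonpos[OF u, of j] by simp
  then have g: "integrable lborel (g j)" "(\<integral>w. g j w \<partial>lborel) = of_real (real_R j u * exp (- s))"
    for j
    using kappa.integrable_laplace_kernel_levy_exponent[OF s, where a = "- u"]
      kappa.integral_laplace_kernel_levy_exponent[OF s, where a = "- u"]
    by (simp_all add: g_def[abs_def] Rfun_eq_levy_exponent real_R_def)
  have "symbol x ((\<i> * of_real w) *s cvec (- u)) * iexp (w * s) * laplace_kernel w
      = g None w + (\<Sum>k\<in>UNIV. g (Some k) w * of_real (x $ k))" for w
    by (simp only: g_def symbol_def riccati_def pairing_def vec_lambda_beta distrib_right
        sum_distrib_right)
       (simp only: mult_ac)
  then show ?thesis
    using g by (simp add: real_symbol_def distrib_left sum_distrib_left mult_ac)
qed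

lemma alpha_None_quadratic_form_neg_cone:
  assumes u: "u \<in> neg_cone I"
  shows "u \<bullet> (alpha None *v u) = 0"
proof -
  have "alpha None $ k $ l * u $ l * u $ k = 0" for k l
    using adm u by (cases "k \<in> I"; cases "l \<in> I") (auto simp: admissible_def neg_cone_def)
  then show ?thesis by (simp only: inner_matrix_vector_mult sum.neutral_const)
qed

lemma integrable_trunc_h_nth_kappa_None:
  assumes "k \<in> I"
  shows "integrable (kappa None) (\<lambda>\<xi>. trunc_h \<xi> $ k)"
proof -
  have "(\<integral>\<^sup>+ \<xi>. ennreal \<bar>trunc_h \<xi> $ k\<bar> \<partial>kappa None) < \<infinity>"
    using adm assms unfolding admissible_def by blast
  then show ?thesis by (intro integrableI_bounded) auto
qed

text \<open>Since \<open>R\<^sub>0\<close> has no diffusion part on the cone and its jumps into \<open>I\<close> are summable, the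
  compensator can be moved into the drift, which admissibility makes nonnegative.\<close>

lemma real_R_None_nonpos:
  assumes u: "u \<in> neg_cone I"
  shows "real_R None u \<le> 0"
proof -
  let ?h = "\<lambda>k. \<integral>\<xi>. trunc_h \<xi> $ k \<partial>kappa None"
  have integrable: "integrable (kappa None) (\<lambda>\<xi>. u $ k * trunc_h \<xi> $ k)" for k
    using integrable_trunc_h_nth_kappa_None[of k] u by (cases "k \<in> I") (auto simp: neg_cone_def)
  have "(\<integral>\<xi>. real_levy_integrand u \<xi> \<partial>kappa None)
      \<le> (\<integral>\<xi>. - (\<Sum>k\<in>UNIV. u $ k * trunc_h \<xi> $ k) \<partial>kappa None)"
  proof (rule integral_mono_AE)
    show "AE \<xi> in kappa None. real_levy_integrand u \<xi> \<le> - (\<Sum>k\<in>UNIV. u $ k * trunc_h \<xi> $ k)"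
      using AE_inner_nonpos[OF u]
      by eventually_elim (simp add: real_levy_integrand_def inner_vec_def)
  qed (use integrable kappa.integrable_real_levy_integrand[OF AE_inner_nonpos[OF u]] in auto)
  also have "\<dots> = - (\<Sum>k\<in>UNIV. u $ k * ?h k)"
    using integrable by simp
  finally have "real_R None u \<le> (\<Sum>k\<in>UNIV. u $ k * (beta None $ k - ?h k)) - gamma None"
    by (simp add: real_R_def real_levy_exponent_def alpha_None_quadratic_form_neg_cone[OF u]
        inner_vec_def[of u "beta None"] right_diff_distrib sum_subtractf)
  also have "\<dots> \<le> 0 - 0"
  proof (intro diff_mono sum_nonpos)
    fix k
    show "u $ k * (beta None $ k - ?h k) \<le> 0"
    proof (cases "k \<in> I")
      case True
      then have "0 \<le> beta None $ k - ?h k" using adm unfolding admissible_def by blast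
      then show ?thesis using u True by (intro mult_nonpos_nonneg) (auto simp: neg_cone_def)
    qed (use u in \<open>auto simp: neg_cone_def\<close>)
    show "0 \<le> gamma None" using adm by (simp add: admissible_def)
  qed
  finally show ?thesis by simp
qed

end

section \<open>Differential inequalities and additive functions\<close>

lemma has_vector_derivative_iff_tendsto_quotient:
  "(f has_vector_derivative D) (at x within S)
      \<longleftrightarrow> ((\<lambda>y. (f y - f x) /\<^sub>R (y - x)) \<longlongrightarrow> D) (at x within S)"
proof -
  have "norm (((f y - f x) - (y - x) *\<^sub>R D) /\<^sub>R norm (y - x)) = norm ((f y - f x) /\<^sub>R (y - x) - D)"
    if "y \<noteq> x" for y
  proof -
    have "(f y - f x) /\<^sub>R (y - x) - D = ((f y - f x) - (y - x) *\<^sub>R D) /\<^sub>R (y - x)"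
      using that by (simp add: scaleR_diff_right)
    then show ?thesis by simp
  qed
  then have "((\<lambda>y. norm (((f y - f x) - (y - x) *\<^sub>R D) /\<^sub>R norm (y - x))) \<longlongrightarrow> 0) (at x within S)
      \<longleftrightarrow> ((\<lambda>y. norm ((f y - f x) /\<^sub>R (y - x) - D)) \<longlongrightarrow> 0) (at x within S)"
    by (intro filterlim_cong) (auto simp: eventually_at_filter)
  then have "((\<lambda>y. ((f y - f x) - (y - x) *\<^sub>R D) /\<^sub>R norm (y - x)) \<longlongrightarrow> 0) (at x within S)
      \<longleftrightarrow> ((\<lambda>y. (f y - f x) /\<^sub>R (y - x)) \<longlongrightarrow> D) (at x within S)"
    by (simp only: tendsto_norm_zero_iff Lim_null[symmetric])
  then show ?thesis
    by (simp add: has_vector_derivative_def has_derivative_at_within bounded_linear_scaleR_left)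
qed

lemma of_real_has_vector_derivative_iff:
  "((\<lambda>s. complex_of_real (f s)) has_vector_derivative of_real D) F \<longleftrightarrow> (f has_real_derivative D) F"
  by (simp add: has_vector_derivative_complex_iff)

lemma has_right_derivative_shift:
  fixes f :: "real \<Rightarrow> real"
  assumes "(f has_real_derivative D) (at_right t)"
  shows "((\<lambda>h. f (t + h)) has_real_derivative D) (at_right 0)"
  using assms unfolding has_field_derivative_iff filterlim_at_right_to_0[of _ _ t]
  by (simp add: add.commute)

lemma eventually_less_at_right:
  fixes f g :: "real \<Rightarrow> real"
  assumes f: "(f has_real_derivative a) (at_right x)"
    and g: "(g has_real_derivative b) (at_right x)"
    and "f x = g x" "a < b"
  shows "\<forall>\<^sub>F y in at_right x. f y < g y"
proof -
  have "((\<lambda>y. g y - f y) has_real_derivative b - a) (at_right x)" by (rule DERIV_diff[OF g f])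
  then obtain d where d: "0 < d" "\<And>h. 0 < h \<Longrightarrow> h < d \<Longrightarrow> g x - f x < g (x + h) - f (x + h)"
    using has_real_derivative_pos_inc_right[of _ "b - a" x "{x<..}"] assms(4) by auto
  have "f y < g y" if "x < y" "y < x + d" for y
    using d(2)[of "y - x"] that assms(3) by simp
  then show ?thesis
    using d(1) by (auto simp: eventually_at_right_field intro!: exI[of _ "x + d"])
qed

lemma norm_increment_le:
  fixes f :: "real \<Rightarrow> 'a::real_normed_vector"
  assumes f: "\<And>t. 0 \<le> t \<Longrightarrow> (f has_vector_derivative f' t) (at t within {0..})"
    and bound: "\<And>t. 0 < t \<Longrightarrow> t < h \<Longrightarrow> norm (f' t) \<le> B" and h: "0 \<le> h"
  shows "norm (f h - f 0) \<le> B * h"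
proof (cases "h = 0")
  case False
  have "continuous_on {0..} f"
    by (rule continuous_on_vector_derivative[of _ _ f']) (use f in auto)
  then have "continuous_on {0..h} f" by (rule continuous_on_subset) auto
  then have "norm (f h - f 0) \<le> B * h - B * 0"
  proof (rule differentiable_bound_general[rotated])
    fix t assume "0 < t" "t < h"
    then show "(f has_vector_derivative f' t) (at t)" "norm (f' t) \<le> B"
      using f[of t] bound at_within_interior[of t "{0..}"] by auto
    show "((*) B has_vector_derivative B) (at t)"
      using has_vector_derivative_mult_right[OF has_vector_derivative_id, of B] by simp
  qed (use False h in \<open>auto intro: continuous_intros\<close>)
  then show ?thesis by simp
qed simp

lemma norm_le_twice_initial_bound:
  fixes f :: "real \<Rightarrow> 'a::real_normed_vector"
  assumes f: "\<And>t. 0 \<le> t \<Longrightarrow> (f has_vector_derivative f' t) (at t within {0..})"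
    and bound: "\<And>t. 0 < t \<Longrightarrow> norm (f t) \<le> 2 * M \<Longrightarrow> norm (f' t) \<le> B"
    and init: "norm (f 0) < M" and B: "0 \<le> B" and s: "0 \<le> s" "s * B \<le> M"
  shows "norm (f s) \<le> 2 * M"
proof (rule ccontr)
  assume large: "\<not> norm (f s) \<le> 2 * M"
  have cont: "continuous_on {0..s} f"
    by (rule continuous_on_subset, rule continuous_on_vector_derivative[of "{0..}" _ f'])
       (use f in auto)
  have "compact ({0..s} \<inter> (\<lambda>t. norm (f t)) -` {2 * M..})"
    by (simp add: compact_eq_bounded_closed bounded_Int continuous_closed_preimage
        continuous_on_norm cont)
  then obtain t where t: "0 \<le> t" "t \<le> s" "2 * M \<le> norm (f t)"
    and first: "\<And>r. 0 \<le> r \<Longrightarrow> r \<le> s \<Longrightarrow> 2 * M \<le> norm (f r) \<Longrightarrow> t \<le> r"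
    using compact_attains_inf[of "{0..s} \<inter> (\<lambda>t. norm (f t)) -` {2 * M..}"] large s by fastforce
  have "norm (f t - f 0) \<le> B * t"
  proof (rule norm_increment_le[OF f])
    fix r assume "0 < r" "r < t"
    then have "\<not> 2 * M \<le> norm (f r)" using first[of r] t by auto
    with \<open>0 < r\<close> show "norm (f' r) \<le> B" by (intro bound) auto
  qed (use t in auto)
  also have "\<dots> \<le> s * B" using mult_left_mono[OF t(2) B] by (simp add: mult.commute)
  finally have "norm (f t) < 2 * M"
    using norm_triangle_sub[of "f t" "f 0"] init s by linarith
  with t show False by simp
qed

lemma interval_closed_induct [consumes 2, case_names base step]:
  fixes a b :: real
  assumes "a \<le> b" and closed: "closed {t \<in> {a..b}. P t}" and base: "P a"
    and step: "\<And>s. a \<le> s \<Longrightarrow> s < b \<Longrightarrow> P s \<Longrightarrow> \<exists>t>s. t \<le> b \<and> P t"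
  shows "P b"
proof -
  let ?S = "{t \<in> {a..b}. P t}"
  have "bounded ?S" by (rule bounded_subset[OF bounded_closed_interval[of a b]]) auto
  with closed have "compact ?S" by (simp only: compact_eq_bounded_closed)
  then obtain s where s: "s \<in> ?S" and max: "\<And>t. t \<in> ?S \<Longrightarrow> t \<le> s"
    using compact_attains_sup[of ?S] assms(1) base by fastforce
  have "\<not> s < b"
  proof
    assume "s < b"
    then obtain t where "s < t" "t \<in> ?S" using step[of s] s by auto
    then show False using max[of t] by simp
  qed
  then show ?thesis using s by auto
qed

lemma one_plus_square_le_if_le_twice:
  fixes a b :: real
  assumes "0 \<le> a" "a \<le> 2 * (1 + b)" "0 \<le> b"
  shows "1 + a\<^sup>2 \<le> 5 * (1 + b)\<^sup>2"
proof -
  have "a\<^sup>2 \<le> (2 * (1 + b))\<^sup>2" using assms by (intro power_mono)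
  moreover have "1 \<le> (1 + b)\<^sup>2" using assms by (intro one_le_power) simp
  ultimately show ?thesis unfolding power_mult_distrib by simp
qed

lemma additive_bounded_above_nonpos:
  fixes f :: "real \<Rightarrow> real"
  assumes add: "\<And>r s. 0 \<le> r \<Longrightarrow> 0 \<le> s \<Longrightarrow> f (r + s) = f r + f s"
    and bound: "\<And>r. 0 \<le> r \<Longrightarrow> f r \<le> K" and r: "0 \<le> r"
  shows "f r \<le> 0"
proof (rule ccontr)
  assume "\<not> f r \<le> 0"
  then obtain n :: nat where n: "K < real n * f r"
    using reals_Archimedean3[of "f r"] by auto
  have "f (real n * r) = real n * f r"
    by (induction n) (use add[of 0 0] r in \<open>auto simp: add algebra_simps\<close>)
  then show False using n bound[of "real n * r"] r by simp
qed

lemma additive_bounded_above_linear: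
  fixes f :: "real \<Rightarrow> real"
  assumes add: "\<And>r s. 0 \<le> r \<Longrightarrow> 0 \<le> s \<Longrightarrow> f (r + s) = f r + f s"
    and bound: "\<And>r. 0 \<le> r \<Longrightarrow> f r \<le> K" and r: "0 \<le> r"
  shows "f r = f 1 * r"
proof -
  have nonpos: "f r \<le> 0" if "0 \<le> r" for r
    using additive_bounded_above_nonpos[of f K] add bound that by blast
  define g where "g r = f r - f 1 * r" for r
  have g_add: "g (r + s) = g r + g s" if "0 \<le> r" "0 \<le> s" for r s
    using add[OF that] by (simp add: g_def algebra_simps)
  \<comment> \<open>g vanishes at the natural numbers, hence is periodic and bounded.\<close>
  have g_nat: "g (real n) = 0" for n
    by (induction n) (use add[of 0 0] in \<open>auto simp: g_def add algebra_simps\<close>)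
  have g_frac: "g r = g (frac r)" if "0 \<le> r" for r
    using g_add[of "real (nat \<lfloor>r\<rfloor>)" "frac r"] g_nat[of "nat \<lfloor>r\<rfloor>"] that by (simp add: frac_def)
  have g_bound: "\<bar>g r\<bar> \<le> - f 1" if "0 \<le> r" for r
  proof -
    have s: "0 \<le> frac r" "frac r \<le> 1" using frac_lt_1[of r] by (auto intro: less_imp_le)
    have "f 1 \<le> f (frac r)" using add[of "frac r" "1 - frac r"] nonpos[of "1 - frac r"] s by simp
    moreover have "f (frac r) \<le> 0" by (rule nonpos[OF s(1)])
    moreover have "f 1 * 1 \<le> f 1 * frac r" "f 1 * frac r \<le> 0"
      using nonpos[of 1] s by (intro mult_left_mono_neg mult_nonpos_nonneg; simp)+
    ultimately have "\<bar>g (frac r)\<bar> \<le> - f 1" unfolding g_def by linarith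
    then show ?thesis using g_frac[OF that] by simp
  qed
  have "g r \<le> 0"
    by (rule additive_bounded_above_nonpos[of g, OF g_add _ r])
       (use g_bound in \<open>auto simp: abs_le_iff\<close>)
  moreover have "- g r \<le> 0"
    by (rule additive_bounded_above_nonpos[of "\<lambda>r. - g r" "- f 1", OF _ _ r])
       (use g_add g_bound in \<open>auto simp: abs_le_iff\<close>)
  ultimately show ?thesis by (simp add: g_def)
qed

lemma sum_axis_nth: "(\<Sum>k\<in>UNIV. axis k (x $ k)) = (x :: real^'d::finite)"
  by (simp add: vec_eq_iff axis_def if_distrib[of "\<lambda>f. f _"] sum.delta)

lemma axis_add: "axis k (r + s) = axis k r + (axis k s :: real^'d::finite)"
  by (simp add: vec_eq_iff axis_def)

lemma additive_bounded_above_on_stateD: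
  fixes L :: "real^'d::finite \<Rightarrow> real"
  assumes add: "\<And>x y. x \<in> stateD I \<Longrightarrow> y \<in> stateD I \<Longrightarrow> L (x + y) = L x + L y"
    and bound: "\<And>x. x \<in> stateD I \<Longrightarrow> L x \<le> K" and x: "x \<in> stateD I"
  shows "L x = (\<Sum>k\<in>I. L (axis k 1) * x $ k)"
proof -
  have L_zero: "L 0 = 0" using add[of 0 0] by simp
  have on_I: "L (axis k r) = L (axis k 1) * r" if "0 \<le> r" for k r
    by (rule additive_bounded_above_linear[of "\<lambda>r. L (axis k r)", OF _ _ that])
       (auto simp: axis_add axis_in_stateD intro!: add bound)
  have off_I: "L (axis k r) = 0" if k: "k \<notin> I" for k r
  proof -
    have half_line: "L (axis k (c * s)) \<le> 0" if "0 \<le> s" for c s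
      by (rule additive_bounded_above_nonpos[of "\<lambda>s. L (axis k (c * s))", OF _ _ that])
         (use k in \<open>auto simp: distrib_left axis_add axis_in_stateD intro!: add bound\<close>)
    have "L (axis k r) + L (axis k (- r)) = L (axis k r + axis k (- r))"
      using k by (intro add[symmetric]) (auto simp: axis_in_stateD)
    also have "axis k r + axis k (- r) = (0 :: real^'d)" by (simp add: vec_eq_iff axis_def)
    finally show ?thesis
      using half_line[of "\<bar>r\<bar>" "sgn r"] half_line[of "\<bar>r\<bar>" "- sgn r"] L_zero
      by (simp add: sgn_mult_abs)
  qed
  have axis: "axis k (x $ k) \<in> stateD I" for k
    using x by (intro axis_in_stateD) (auto simp: stateD_def)
  have "L (\<Sum>k\<in>S. axis k (x $ k)) = (\<Sum>k\<in>S. L (axis k (x $ k)))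
      \<and> (\<Sum>k\<in>S. axis k (x $ k)) \<in> stateD I" for S
    by (induction S rule: finite_induct[OF finite]) (simp_all add: L_zero add axis add_in_stateD)
  from this[of UNIV] have "L x = (\<Sum>k\<in>UNIV. L (axis k (x $ k)))" by (simp add: sum_axis_nth)
  also have "\<dots> = (\<Sum>k\<in>I. L (axis k 1) * x $ k)"
    using x by (intro sum.mono_neutral_cong_right) (auto simp: off_I stateD_def intro: on_I)
  finally show ?thesis .
qed

lemma Im_eq_0_if_exp_nonneg:
  fixes z :: complex
  assumes "\<And>r. 0 \<le> r \<Longrightarrow> 0 \<le> Re (exp (z * of_real r))"
  shows "Im z = 0"
proof (rule ccontr)
  assume Im: "Im z \<noteq> 0"
  define r where "r = pi / \<bar>Im z\<bar>"
  have "cos (Im z * r) = cos \<bar>Im z * r\<bar>" by simp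
  also have "\<dots> = -1" using Im by (simp add: r_def abs_mult)
  finally have "Re (exp (z * of_real r)) = - exp (Re z * r)" by (simp add: Re_exp)
  then show False using assms[of r] by (simp add: r_def not_le[symmetric])
qed

section \<open>Fourier and Laplace transforms of the transition function\<close>

locale affine_process = affine_parameters I alpha beta gamma kappa
  for I :: "'d::finite set"
    and alpha :: "'d option \<Rightarrow> real^'d^'d" and beta :: "'d option \<Rightarrow> real^'d"
    and gamma :: "'d option \<Rightarrow> real" and kappa :: "'d option \<Rightarrow> (real^'d) measure" +
  fixes p :: "real \<Rightarrow> real^'d \<Rightarrow> (real^'d) measure"
    and psi0 :: "real \<Rightarrow> real^'d \<Rightarrow> complex"
    and psi :: "real \<Rightarrow> real^'d \<Rightarrow> complex^'d"
  assumes markov: "transition_function I p"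
    and affine: "affine_with I p psi0 psi"
    and ode_psi: "\<And>v t. t \<ge> 0 \<Longrightarrow>
        ((\<lambda>s. psi s v) has_vector_derivative (\<chi> k. R (Some k) (psi t v))) (at t within {0..})"
    and init_psi: "\<And>v. psi 0 v = (\<chi> k. \<i> * of_real (v $ k))"
    and ode_psi0: "\<And>v t. t \<ge> 0 \<Longrightarrow>
        ((\<lambda>s. psi0 s v) has_vector_derivative R None (psi t v)) (at t within {0..})"
    and init_psi0: "\<And>v. psi0 0 v = 0"
begin

lemma sets_p [simp]: "t \<ge> 0 \<Longrightarrow> x \<in> stateD I \<Longrightarrow> sets (p t x) = sets borel"
  and subprob_p: "t \<ge> 0 \<Longrightarrow> x \<in> stateD I \<Longrightarrow> subprob_space (p t x)"
  using markov by (auto simp: transition_function_def)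

lemma space_p [simp]: "t \<ge> 0 \<Longrightarrow> x \<in> stateD I \<Longrightarrow> space (p t x) = UNIV"
  using sets_eq_imp_space_eq[OF sets_p] by simp

lemma finite_p: "t \<ge> 0 \<Longrightarrow> x \<in> stateD I \<Longrightarrow> finite_measure (p t x)"
  using subprob_p subprob_space_def by blast

lemma measurable_p [simp]: "t \<ge> 0 \<Longrightarrow> x \<in> stateD I \<Longrightarrow> measurable (p t x) N = measurable borel N"
  by (rule measurable_cong_sets) auto

lemma AE_p: "t \<ge> 0 \<Longrightarrow> x \<in> stateD I \<Longrightarrow> AE \<xi> in p t x. \<xi> \<in> stateD I"
  by (rule AE_I[where N="UNIV - stateD I"]) (use markov in \<open>auto simp: transition_function_def\<close>)

lemma p_zero: "x \<in> stateD I \<Longrightarrow> p 0 x = return borel x"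
  using markov by (simp add: transition_function_def)

definition fourier :: "real \<Rightarrow> real^'d \<Rightarrow> real^'d \<Rightarrow> complex" where
  "fourier t v x = exp (psi0 t v + pairing (psi t v) x)"

definition laplace :: "real \<Rightarrow> real^'d \<Rightarrow> real^'d \<Rightarrow> real" where
  "laplace t u x = (\<integral>\<xi>. exp (u \<bullet> \<xi>) \<partial>p t x)"

lemma fourier_eq_integral:
  assumes "t \<ge> 0" "x \<in> stateD I"
  shows "fourier t v x = (\<integral>\<xi>. iexp (v \<bullet> \<xi>) \<partial>p t x)"
proof -
  have "\<i> * of_real (v \<bullet> \<xi>) = (\<Sum>k\<in>UNIV. (\<i> * of_real (v $ k)) * complex_of_real (\<xi> $ k))" for \<xi>
    by (simp add: inner_vec_def sum_distrib_left mult_ac)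
  then show ?thesis
    using affine assms unfolding affine_with_def fourier_def pairing_def by (simp only:)
qed

lemma norm_fourier_le_1:
  assumes "t \<ge> 0" "x \<in> stateD I"
  shows "norm (fourier t v x) \<le> 1"
proof -
  interpret subprob_space "p t x" by (rule subprob_p[OF assms])
  have "norm (fourier t v x) \<le> (\<integral>\<xi>. norm (iexp (v \<bullet> \<xi>)) \<partial>p t x)"
    unfolding fourier_eq_integral[OF assms] by (rule integral_norm_bound)
  also have "\<dots> = measure (p t x) (space (p t x))" by simp
  also have "\<dots> \<le> 1" by (rule subprob_measure_le_1)
  finally show ?thesis .
qed

lemma fourier_mult: "fourier t v x * fourier t v y = fourier t v (x + y) * fourier t v 0"
  by (simp add: fourier_def pairing_add_right flip: exp_add)

lemma psi_zero_time: "psi 0 v = \<i> *s cvec v"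
  by (simp add: init_psi vec_eq_iff)

lemma fourier_zero_time: "fourier 0 v x = iexp (v \<bullet> x)"
  by (simp add: fourier_def init_psi0 psi_zero_time pairing_smult pairing_cvec)

lemma psi_in_left_cone:
  assumes t: "t \<ge> 0"
  shows "psi t v \<in> left_cone I"
proof -
  have bounded: "Re (psi0 t v) + Re (psi t v $ k) * r \<le> 0" if "0 \<le> r \<or> k \<notin> I" for k r
    using norm_fourier_le_1[OF t axis_in_stateD[OF that], of v]
    by (simp add: fourier_def pairing_axis)
  have slope_nonpos: "c \<le> 0" if bound: "\<And>r. 0 \<le> r \<Longrightarrow> b + c * r \<le> 0" for b c :: real
  proof -
    have "c * r \<le> - b" if "0 \<le> r" for r using bound[OF that] by linarith
    then show ?thesis using additive_bounded_above_nonpos[of "(*) c" "- b" 1]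
      by (simp add: distrib_left)
  qed
  have "Re (psi t v $ k) \<le> 0" for k
    by (rule slope_nonpos[of "Re (psi0 t v)"]) (use bounded[of _ k] in auto)
  moreover have "- Re (psi t v $ k) \<le> 0" if "k \<notin> I" for k
    by (rule slope_nonpos[of "Re (psi0 t v)"]) (use bounded[of "- _" k] that in auto)
  ultimately show ?thesis by (auto simp: left_cone_def neg_cone_def intro!: antisym)
qed

lemma psi_has_vector_derivative:
  "t \<ge> 0 \<Longrightarrow> ((\<lambda>s. psi s v) has_vector_derivative riccati (psi t v)) (at t within {0..})"
  using ode_psi by (simp add: riccati_def)

lemma fourier_has_vector_derivative:
  assumes t: "t \<ge> 0"
  shows "((\<lambda>s. fourier s v x) has_vector_derivative symbol x (psi t v) * fourier t v x)
    (at t within {0..})"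
proof -
  have "((\<lambda>s. psi0 s v + pairing (psi s v) x) has_vector_derivative symbol x (psi t v))
      (at t within {0..})"
    unfolding symbol_def
    by (intro has_vector_derivative_add ode_psi0 psi_has_vector_derivative t
        bounded_linear.has_vector_derivative[OF bounded_linear_pairing])
  note field_vector_diff_chain_within[OF this has_field_derivative_at_within[OF DERIV_exp]]
  then show ?thesis unfolding fourier_def comp_def by simp
qed

lemma continuous_on_fourier: "continuous_on {0..} (\<lambda>t. fourier t v x)"
  by (rule continuous_on_vector_derivative[OF fourier_has_vector_derivative]) auto

text \<open>The Riccati function grows quadratically, so started from a vector of norm \<open>M\<close> the flow is
  controlled only for times of order \<open>1/M\<close>. For longer times the trivial bound by 2 on increments of
  the Fourier transform is of the right order.\<close>

lemma psi_short_time_bound: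
  obtains K where "0 \<le> K"
    "\<And>v s. 0 \<le> s \<Longrightarrow> s * (K * (1 + norm v)) \<le> 1 \<Longrightarrow> norm (psi s v) \<le> 2 * (1 + norm v)"
proof -
  obtain C where C: "0 \<le> C" "\<And>u. u \<in> left_cone I \<Longrightarrow> norm (riccati u) \<le> C * (1 + (norm u)\<^sup>2)"
    using riccati_quadratic_growth by blast
  have "norm (psi s v) \<le> 2 * (1 + norm v)" if s: "0 \<le> s" "s * (5 * C * (1 + norm v)) \<le> 1" for s v
  proof (rule norm_le_twice_initial_bound[OF psi_has_vector_derivative _ _ _ s(1)])
    fix t :: real assume t: "0 < t" "norm (psi t v) \<le> 2 * (1 + norm v)"
    have "norm (riccati (psi t v)) \<le> C * (1 + (norm (psi t v))\<^sup>2)"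
      using t by (intro C(2) psi_in_left_cone) simp
    also have "\<dots> \<le> C * (5 * (1 + norm v)\<^sup>2)"
      using t by (intro mult_left_mono C(1) one_plus_square_le_if_le_twice) auto
    finally show "norm (riccati (psi t v)) \<le> 5 * C * (1 + norm v) * (1 + norm v)"
      by (simp add: power2_eq_square mult_ac)
  next
    show "norm (psi 0 v) < 1 + norm v" by (simp add: psi_zero_time norm_smult_cvec)
    show "0 \<le> 5 * C * (1 + norm v) * (1 + norm v)" using C by simp
    show "s * (5 * C * (1 + norm v) * (1 + norm v)) \<le> 1 + norm v"
      using mult_right_mono[OF s(2), of "1 + norm v"] by (simp add: mult_ac)
  qed
  with C(1) that[of "5 * C"] show thesis by simp
qed

lemma fourier_short_time_increment:
  assumes x: "x \<in> stateD I" and h: "0 \<le> h"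
    and psi: "\<And>s. 0 \<le> s \<Longrightarrow> s \<le> h \<Longrightarrow> norm (psi s v) \<le> 2 * (1 + norm v)"
    and C: "0 \<le> C" "\<And>u. u \<in> left_cone I \<Longrightarrow> norm (symbol x u) \<le> C * (1 + (norm u)\<^sup>2)"
  shows "norm (fourier h v x - fourier 0 v x) \<le> 5 * C * (1 + norm v)\<^sup>2 * h"
proof (rule norm_increment_le[OF fourier_has_vector_derivative _ h])
  fix t assume t: "0 < t" "t < h"
  have "norm (symbol x (psi t v)) * norm (fourier t v x) \<le> norm (symbol x (psi t v)) * 1"
    using t x by (intro mult_left_mono norm_fourier_le_1) auto
  also have "\<dots> \<le> C * (1 + (norm (psi t v))\<^sup>2)"
    using C(2)[OF psi_in_left_cone] t by simp
  also have "\<dots> \<le> C * (5 * (1 + norm v)\<^sup>2)"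
    using t psi by (intro mult_left_mono C(1) one_plus_square_le_if_le_twice) auto
  finally show "norm (symbol x (psi t v) * fourier t v x) \<le> 5 * C * (1 + norm v)\<^sup>2"
    by (simp add: norm_mult)
qed

lemma fourier_increment_bound:
  assumes x: "x \<in> stateD I"
  obtains C where "0 \<le> C"
    "\<And>v h. 0 \<le> h \<Longrightarrow> norm (fourier h v x - fourier 0 v x) \<le> C * (1 + (norm v)\<^sup>2) * h"
proof -
  obtain C where C: "0 \<le> C" "\<And>u. u \<in> left_cone I \<Longrightarrow> norm (symbol x u) \<le> C * (1 + (norm u)\<^sup>2)"
    using symbol_quadratic_growth by blast
  obtain K where K: "0 \<le> K"
    "\<And>v s. 0 \<le> s \<Longrightarrow> s * (K * (1 + norm v)) \<le> 1 \<Longrightarrow> norm (psi s v) \<le> 2 * (1 + norm v)"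
    using psi_short_time_bound by blast
  have "norm (fourier h v x - fourier 0 v x) \<le> (10 * C + 4 * K) * (1 + (norm v)\<^sup>2) * h"
    if h: "0 \<le> h" for v h
  proof -
    define M where "M = 1 + norm v"
    have M: "1 \<le> M" "M\<^sup>2 \<le> 2 * (1 + (norm v)\<^sup>2)"
      using sum_squares_bound[of "norm v" 1] by (simp_all add: M_def power2_sum)
    have "norm (fourier h v x - fourier 0 v x) \<le> (5 * C + 2 * K) * M\<^sup>2 * h"
    proof (cases "h * (K * M) \<le> 1")
      case True
      have "norm (psi s v) \<le> 2 * (1 + norm v)" if "0 \<le> s" "s \<le> h" for s
        using that True mult_right_mono[OF that(2), of "K * M"] K(1) M(1)
        by (intro K(2)) (auto simp: M_def)
      from fourier_short_time_increment[OF x h this C]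
      have "norm (fourier h v x - fourier 0 v x) \<le> 5 * C * M\<^sup>2 * h" by (simp add: M_def)
      also have "\<dots> \<le> (5 * C + 2 * K) * M\<^sup>2 * h"
        using K(1) h by (intro mult_right_mono) auto
      finally show ?thesis .
    next
      case False
      have "norm (fourier h v x - fourier 0 v x) \<le> 1 + 1"
        using h x by (intro order_trans[OF norm_triangle_ineq4] add_mono norm_fourier_le_1) auto
      also have "\<dots> \<le> 2 * (h * (K * M))" using False by simp
      also have "\<dots> \<le> 2 * K * M\<^sup>2 * h"
        using mult_left_mono[OF M(1), of "h * K * M"] K(1) h M(1)
        by (simp add: power2_eq_square mult_ac)
      also have "\<dots> \<le> (5 * C + 2 * K) * M\<^sup>2 * h"
        using C(1) h by (intro mult_right_mono) auto
      finally show ?thesis .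
    qed
    also have "\<dots> \<le> (5 * C + 2 * K) * (2 * (1 + (norm v)\<^sup>2)) * h"
      using C(1) K(1) h M(2) by (intro mult_right_mono mult_left_mono) auto
    finally show ?thesis by (simp add: algebra_simps)
  qed
  with C(1) K(1) that[of "10 * C + 4 * K"] show thesis by simp
qed

lemma fourier_ray_measurable:
  assumes "t \<ge> 0" "x \<in> stateD I"
  shows "(\<lambda>w. fourier t (w *\<^sub>R a) x) \<in> borel_measurable borel"
proof -
  interpret finite_measure "p t x" by (rule finite_p[OF assms])
  have [measurable_cong]: "sets (p t x) = sets borel" using assms by simp
  show ?thesis unfolding fourier_eq_integral[OF assms] by measurable
qed

lemma AE_inner_p_nonpos:
  assumes "u \<in> neg_cone I" "t \<ge> 0" "x \<in> stateD I"
  shows "AE \<xi> in p t x. u \<bullet> \<xi> \<le> 0"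
  using AE_p[OF assms(2,3)] by eventually_elim (rule inner_neg_cone_stateD_nonpos[OF assms(1)])

lemma integrable_exp_inner:
  assumes "u \<in> neg_cone I" "t \<ge> 0" "x \<in> stateD I"
  shows "integrable (p t x) (\<lambda>\<xi>. exp (u \<bullet> \<xi>))"
proof -
  interpret finite_measure "p t x" by (rule finite_p[OF assms(2,3)])
  show ?thesis
    by (rule integrable_const_bound[where B=1]) (use AE_inner_p_nonpos[OF assms] assms in auto)
qed

lemma laplace_by_fourier:
  assumes u: "u \<in> neg_cone I" and t: "t \<ge> 0" and x: "x \<in> stateD I"
  shows "complex_of_real (laplace t u x) = (\<integral>w. fourier t (w *\<^sub>R - u) x * laplace_kernel w \<partial>lborel)"
proof -
  have "AE \<xi> in p t x. 0 \<le> - (u \<bullet> \<xi>)" using AE_inner_p_nonpos[OF u t x] by simp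
  from laplace_by_characteristic[OF finite_p[OF t x] _ this] t x show ?thesis
    by (simp add: laplace_def fourier_eq_integral)
qed

lemma laplace_mult_by_fourier:
  assumes u: "u \<in> neg_cone I" and t: "t \<ge> 0" and x: "x \<in> stateD I" and y: "y \<in> stateD I"
  shows "complex_of_real (laplace t u x * laplace t u y)
    = (\<integral>w. fourier t (w *\<^sub>R - u) x * fourier t (w *\<^sub>R - u) y * laplace_kernel w \<partial>lborel)"
proof -
  have "AE \<xi> in p t z. 0 \<le> - (u \<bullet> \<xi>)" if "z \<in> stateD I" for z
    using AE_inner_p_nonpos[OF u t that] by simp
  from laplace_mult_by_characteristic[OF finite_p finite_p _ _ this this, OF t x t y _ _ x y]
  show ?thesis using t x y by (simp add: laplace_def fourier_eq_integral)
qed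

lemma laplace_mult:
  assumes "u \<in> neg_cone I" "t \<ge> 0" "x \<in> stateD I" "y \<in> stateD I"
  shows "laplace t u x * laplace t u y = laplace t u (x + y) * laplace t u 0"
proof -
  have "complex_of_real (laplace t u x * laplace t u y)
      = (\<integral>w. fourier t (w *\<^sub>R - u) x * fourier t (w *\<^sub>R - u) y * laplace_kernel w \<partial>lborel)"
    by (rule laplace_mult_by_fourier[OF assms])
  also have "\<dots> = (\<integral>w. fourier t (w *\<^sub>R - u) (x + y) * fourier t (w *\<^sub>R - u) 0
      * laplace_kernel w \<partial>lborel)"
    by (simp only: fourier_mult[of _ _ x y])
  also have "\<dots> = of_real (laplace t u (x + y) * laplace t u 0)"
    using assms by (intro laplace_mult_by_fourier[symmetric] add_in_stateD zero_in_stateD)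
  finally show ?thesis using of_real_eq_iff by blast
qed

lemma laplace_zero_time: "x \<in> stateD I \<Longrightarrow> laplace 0 u x = exp (u \<bullet> x)"
  by (simp add: laplace_def p_zero integral_return)

lemma continuous_on_laplace:
  assumes u: "u \<in> neg_cone I" and x: "x \<in> stateD I"
  shows "continuous_on {0..} (\<lambda>t. laplace t u x)"
proof (rule continuous_on_sequentiallyI)
  fix s :: "nat \<Rightarrow> real" and t :: real assume s: "\<forall>n. s n \<in> {0..}" "t \<in> {0..}" "s \<longlonglongrightarrow> t"
  have "(\<lambda>n. \<integral>w. fourier (s n) (w *\<^sub>R - u) x * laplace_kernel w \<partial>lborel)
      \<longlonglongrightarrow> (\<integral>w. fourier t (w *\<^sub>R - u) x * laplace_kernel w \<partial>lborel)"
  proof (rule laplace_kernel_dominated_convergence[where C = 1])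
    show "(\<lambda>n. fourier (s n) (w *\<^sub>R - u) x) \<longlonglongrightarrow> fourier t (w *\<^sub>R - u) x" for w
      using continuous_on_fourier[of "w *\<^sub>R - u" x] s
      unfolding continuous_on_sequentially comp_def by auto
    show "norm (fourier (s n) (w *\<^sub>R - u) x) \<le> 1 * (1 + w\<^sup>2)" for n w
      using norm_fourier_le_1[of "s n" x "w *\<^sub>R - u"] s x by (simp add: add_increasing2)
  qed (use s x in \<open>intro fourier_ray_measurable; simp\<close>)
  then have "(\<lambda>n. complex_of_real (laplace (s n) u x)) \<longlonglongrightarrow> of_real (laplace t u x)"
    using laplace_by_fourier[OF u _ x] s by simp
  then show "(\<lambda>n. laplace (s n) u x) \<longlonglongrightarrow> laplace t u x"
    by (simp only: tendsto_of_real_iff)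
qed

lemma fourier_quotient_tendsto:
  assumes X: "\<And>n. 0 < X n" "X \<longlonglongrightarrow> 0"
  shows "(\<lambda>n. (fourier (X n) (w *\<^sub>R a) x - fourier 0 (w *\<^sub>R a) x) /\<^sub>R X n)
      \<longlonglongrightarrow> symbol x ((\<i> * of_real w) *s cvec a) * iexp (w * (a \<bullet> x))"
proof -
  have "psi 0 (w *\<^sub>R a) = (\<i> * of_real w) *s cvec a"
    by (simp add: psi_zero_time vec_eq_iff)
  then have "((\<lambda>t. fourier t (w *\<^sub>R a) x) has_vector_derivative
      symbol x ((\<i> * of_real w) *s cvec a) * iexp (w * (a \<bullet> x))) (at 0 within {0..})"
    using fourier_has_vector_derivative[of 0 "w *\<^sub>R a" x] by (simp add: fourier_zero_time)
  then show ?thesis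
    unfolding has_vector_derivative_iff_tendsto_quotient tendsto_at_iff_sequentially
    using X by (auto simp: comp_def less_imp_le less_imp_neq[THEN not_sym])
qed

lemma laplace_quotient_by_fourier:
  assumes u: "u \<in> neg_cone I" and x: "x \<in> stateD I" and h: "0 \<le> h"
  shows "complex_of_real ((laplace h u x - laplace 0 u x) / h)
      = (\<integral>w. (fourier h (w *\<^sub>R - u) x - fourier 0 (w *\<^sub>R - u) x) /\<^sub>R h * laplace_kernel w \<partial>lborel)"
proof -
  have integrable: "integrable lborel (\<lambda>w. fourier t (w *\<^sub>R - u) x * laplace_kernel w)" if "0 \<le> t"
    for t
    using norm_fourier_le_1[OF that x]
    by (intro integrable_times_laplace_kernel[where C = 1] fourier_ray_measurable that x)
       (simp add: add_increasing2)
  have "(\<integral>w. (fourier h (w *\<^sub>R - u) x - fourier 0 (w *\<^sub>R - u) x) /\<^sub>R h * laplace_kernel w \<partial>lborel)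
      = (\<integral>w. (fourier h (w *\<^sub>R - u) x * laplace_kernel w
          - fourier 0 (w *\<^sub>R - u) x * laplace_kernel w) / of_real h \<partial>lborel)"
    by (simp add: scaleR_conv_of_real divide_inverse algebra_simps)
  also have "\<dots> = complex_of_real ((laplace h u x - laplace 0 u x) / h)"
    using integrable h by (simp add: Bochner_Integration.integral_diff laplace_by_fourier[OF u _ x])
  finally show ?thesis ..
qed

lemma laplace_has_right_derivative:
  assumes u: "u \<in> neg_cone I" and x: "x \<in> stateD I"
  shows "((\<lambda>t. laplace t u x) has_real_derivative real_symbol x u * exp (u \<bullet> x)) (at_right 0)"
  unfolding has_field_derivative_iff tendsto_at_iff_sequentially
proof (intro allI impI)
  fix X :: "nat \<Rightarrow> real" assume "\<forall>n. X n \<in> {0<..} - {0}" and lim: "X \<longlonglongrightarrow> 0"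
  then have X: "0 < X n" for n by auto
  obtain C where C: "0 \<le> C"
    "\<And>v h. 0 \<le> h \<Longrightarrow> norm (fourier h v x - fourier 0 v x) \<le> C * (1 + (norm v)\<^sup>2) * h"
    using fourier_increment_bound[OF x] by blast
  let ?q = "\<lambda>n w. (fourier (X n) (w *\<^sub>R - u) x - fourier 0 (w *\<^sub>R - u) x) /\<^sub>R X n"
  let ?D = "\<lambda>w. symbol x ((\<i> * of_real w) *s cvec (- u)) * iexp (w * (- u \<bullet> x))"
  have "(\<lambda>n. \<integral>w. ?q n w * laplace_kernel w \<partial>lborel) \<longlonglongrightarrow> (\<integral>w. ?D w * laplace_kernel w \<partial>lborel)"
  proof (rule laplace_kernel_dominated_convergence)
    fix n w
    have "norm (?q n w) \<le> C * (1 + (norm (w *\<^sub>R - u))\<^sup>2)"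
      using C(2)[of "X n" "w *\<^sub>R - u"] X[of n]
      by (simp add: divide_inverse_commute[symmetric] pos_divide_le_eq)
    also have "\<dots> \<le> C * ((1 + (norm u)\<^sup>2) * (1 + w\<^sup>2))"
      using C(1) by (intro mult_left_mono) (auto simp: power_mult_distrib algebra_simps)
    finally show "norm (?q n w) \<le> C * (1 + (norm u)\<^sup>2) * (1 + w\<^sup>2)" by (simp only: mult.assoc)
    show "(\<lambda>n. ?q n w) \<longlonglongrightarrow> ?D w" by (rule fourier_quotient_tendsto[OF X lim])
    show "?q n \<in> borel_measurable borel"
      using X[of n] x
      by (intro borel_measurable_scaleR borel_measurable_diff fourier_ray_measurable) auto
  qed
  also have "(\<integral>w. ?D w * laplace_kernel w \<partial>lborel) = of_real (real_symbol x u * exp (- (- u \<bullet> x)))"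
    using inner_neg_cone_stateD_nonpos[OF u x] by (intro integral_laplace_kernel_symbol u) simp
  finally have "(\<lambda>n. (laplace (X n) u x - laplace 0 u x) / X n) \<longlonglongrightarrow> real_symbol x u * exp (u \<bullet> x)"
    unfolding laplace_quotient_by_fourier[OF u x less_imp_le[OF X], symmetric] tendsto_of_real_iff
    by simp
  then show "((\<lambda>t. (laplace t u x - laplace 0 u x) / (t - 0)) \<circ> X) \<longlonglongrightarrow> real_symbol x u * exp (u \<bullet> x)"
    by (simp add: comp_def)
qed

lemma of_real_mass_eq_fourier:
  assumes "t \<ge> 0" "x \<in> stateD I"
  shows "complex_of_real (measure (p t x) UNIV) = fourier t 0 x"
  using assms by (simp add: fourier_eq_integral scaleR_conv_of_real)

lemma mass_pos:
  assumes "t \<ge> 0" "x \<in> stateD I"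
  shows "0 < measure (p t x) UNIV"
proof -
  have "measure (p t x) UNIV \<noteq> 0" using of_real_mass_eq_fourier[OF assms]
    by (auto simp: fourier_def)
  then show ?thesis by (simp add: zero_less_measure_iff)
qed

lemma laplace_pos:
  assumes "u \<in> neg_cone I" and t: "t \<ge> 0" and x: "x \<in> stateD I"
  shows "0 < laplace t u x"
proof -
  have "laplace t u x \<noteq> 0"
  proof
    assume "laplace t u x = 0"
    then have "AE \<xi> in p t x. exp (u \<bullet> \<xi>) = 0"
      using integral_nonneg_eq_0_iff_AE[OF integrable_exp_inner[OF assms]]
      by (simp add: laplace_def)
    then have "emeasure (p t x) UNIV = 0" using t x by (simp add: AE_iff_null null_sets_def)
    then show False using mass_pos[OF t x] by (simp add: measure_def)
  qed
  moreover have "0 \<le> laplace t u x" unfolding laplace_def by simp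
  ultimately show ?thesis by simp
qed

lemma laplace_le_1:
  assumes u: "u \<in> neg_cone I" and t: "t \<ge> 0" and x: "x \<in> stateD I"
  shows "laplace t u x \<le> 1"
proof -
  interpret subprob_space "p t x" by (rule subprob_p[OF t x])
  have "laplace t u x \<le> (\<integral>\<xi>. 1 \<partial>p t x)"
    unfolding laplace_def
    by (rule integral_mono_AE)
       (use integrable_exp_inner[OF u t x] AE_inner_p_nonpos[OF u t x] in auto)
  also have "\<dots> \<le> 1" using subprob_measure_le_1[of UNIV] t x by simp
  finally show ?thesis .
qed

definition laplace_exponent0 :: "real \<Rightarrow> real^'d \<Rightarrow> real" where
  "laplace_exponent0 t u = ln (laplace t u 0)"

definition laplace_exponent :: "real \<Rightarrow> real^'d \<Rightarrow> 'd \<Rightarrow> real" where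
  "laplace_exponent t u k = ln (laplace t u (axis k 1)) - ln (laplace t u 0)"

lemma laplace_exp_affine:
  assumes u: "u \<in> neg_cone I" and t: "t \<ge> 0" and x: "x \<in> stateD I"
  shows "laplace t u x = exp (laplace_exponent0 t u + (\<Sum>k\<in>I. laplace_exponent t u k * x $ k))"
proof -
  define L where "L x = ln (laplace t u x) - ln (laplace t u 0)" for x
  note pos = laplace_pos[OF u t]
  have "L x = (\<Sum>k\<in>I. L (axis k 1) * x $ k)"
  proof (rule additive_bounded_above_on_stateD[OF _ _ x])
    fix x y assume xy: "x \<in> stateD I" "y \<in> stateD I"
    have "ln (laplace t u x * laplace t u y) = ln (laplace t u (x + y) * laplace t u 0)"
      by (simp only: laplace_mult[OF u t xy])
    then show "L (x + y) = L x + L y"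
      using pos[OF xy(1)] pos[OF xy(2)] pos[OF add_in_stateD[OF xy]] pos[OF zero_in_stateD]
      by (simp add: L_def ln_mult)
    show "L x \<le> - ln (laplace t u 0)" using pos[OF xy(1)] laplace_le_1[OF u t xy(1)]
      by (simp add: L_def)
  qed
  then have "ln (laplace t u x) = laplace_exponent0 t u + (\<Sum>k\<in>I. laplace_exponent t u k * x $ k)"
    by (simp add: L_def laplace_exponent0_def laplace_exponent_def)
  then show ?thesis using pos[OF x] by (metis exp_ln)
qed

lemma ln_laplace_has_right_derivative:
  assumes u: "u \<in> neg_cone I" and x: "x \<in> stateD I"
  shows "((\<lambda>t. ln (laplace t u x)) has_real_derivative real_symbol x u) (at_right 0)"
proof -
  have "((\<lambda>t. ln (laplace t u x)) has_real_derivative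
      1 / laplace 0 u x * (real_symbol x u * exp (u \<bullet> x))) (at_right 0)"
    by (rule DERIV_chain2[OF DERIV_ln_divide laplace_has_right_derivative[OF u x]])
       (rule laplace_pos[OF u _ x], simp)
  then show ?thesis by (simp add: laplace_zero_time[OF x])
qed

lemma laplace_exponent0_has_right_derivative:
  assumes "u \<in> neg_cone I"
  shows "((\<lambda>t. laplace_exponent0 t u) has_real_derivative real_R None u) (at_right 0)"
  using ln_laplace_has_right_derivative[OF assms zero_in_stateD]
  by (simp add: laplace_exponent0_def real_symbol_def)

lemma laplace_exponent_has_right_derivative:
  assumes "u \<in> neg_cone I"
  shows "((\<lambda>t. laplace_exponent t u k) has_real_derivative real_R (Some k) u) (at_right 0)"
proof -
  have "axis k 1 \<in> stateD I" by (simp add: axis_in_stateD)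
  then have "((\<lambda>t. laplace_exponent t u k) has_real_derivative
      real_symbol (axis k 1) u - real_symbol 0 u) (at_right 0)"
    unfolding laplace_exponent_def
    by (intro DERIV_diff ln_laplace_has_right_derivative assms zero_in_stateD)
  also have "real_symbol (axis k 1) u - real_symbol 0 u = real_R (Some k) u"
    by (simp add: real_symbol_def axis_def if_distrib[of "\<lambda>r. _ * r"] cong: if_cong)
  finally show ?thesis .
qed

lemma laplace_exponent_zero_time:
  "laplace_exponent0 0 u = 0" "laplace_exponent 0 u k = u $ k"
  by (simp_all add: laplace_exponent0_def laplace_exponent_def laplace_zero_time axis_in_stateD
      inner_axis)

section \<open>Comparison with supersolutions\<close>

lemma transition_kernel_measurable:
  assumes s: "s \<ge> 0" and t: "t \<ge> 0" and x: "x \<in> stateD I"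
  shows "p t \<in> measurable (restrict_space (p s x) (stateD I)) (subprob_algebra borel)"
proof (rule measurable_subprob_algebra)
  fix A :: "(real^'d) set" assume "A \<in> sets borel"
  then have "(\<lambda>y. emeasure (p t y) A) \<in> borel_measurable (restrict_space borel (stateD I))"
    using markov t by (simp add: transition_function_def)
  moreover have "sets (restrict_space (p s x) (stateD I)) = sets (restrict_space borel (stateD I))"
    using s x by (intro sets_restrict_space_cong) auto
  ultimately show "(\<lambda>y. emeasure (p t y) A) \<in> borel_measurable (restrict_space (p s x) (stateD I))"
    by (simp cong: measurable_cong_sets)
qed (use s t x subprob_p in \<open>auto simp: space_restrict_space\<close>)

lemma nn_integral_Chapman_Kolmogorov:
  assumes s: "s \<ge> 0" and t: "t \<ge> 0" and x: "x \<in> stateD I" and f: "f \<in> borel_measurable borel"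
  shows "(\<integral>\<^sup>+ \<xi>. f \<xi> \<partial>p (s + t) x) = (\<integral>\<^sup>+ y. \<integral>\<^sup>+ \<xi>. f \<xi> \<partial>p t y \<partial>p s x)"
proof -
  let ?N = "restrict_space (p s x) (stateD I)"
  note K = transition_kernel_measurable[OF s t x]
  have space: "space ?N = stateD I" using s x by (simp add: space_restrict_space)
  then have nonempty: "space ?N \<noteq> {}" using x by auto
  have restrict: "(\<integral>\<^sup>+ y. F y \<partial>?N) = (\<integral>\<^sup>+ y. F y \<partial>p s x)" for F
  proof -
    have "stateD I \<inter> space (p s x) \<in> sets (p s x)" using s x by simp
    from nn_integral_restrict_space[OF this] show ?thesis
      by (simp, intro nn_integral_cong_AE) (use AE_p[OF s x] in \<open>eventually_elim, simp\<close>)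
  qed
  have "p (s + t) x = ?N \<bind> p t"
  proof (rule measure_eqI)
    show "sets (p (s + t) x) = sets (?N \<bind> p t)"
      using s t x sets_bind[OF _ nonempty, of "p t" borel] by (simp add: space)
    fix A assume "A \<in> sets (p (s + t) x)"
    then have A: "A \<in> sets borel" using s t x by simp
    then have "emeasure (p (s + t) x) A = (\<integral>\<^sup>+ y. emeasure (p t y) A \<partial>p s x)"
      using markov s t x by (simp add: transition_function_def)
    then show "emeasure (p (s + t) x) A = emeasure (?N \<bind> p t) A"
      by (simp add: emeasure_bind[OF nonempty K A] restrict)
  qed
  then show ?thesis by (simp add: nn_integral_bind[OF f K] restrict)
qed

lemma nn_integral_exp_inner:
  assumes "u \<in> neg_cone I" "t \<ge> 0" "x \<in> stateD I"
  shows "(\<integral>\<^sup>+ \<xi>. ennreal (exp (u \<bullet> \<xi>)) \<partial>p t x) = ennreal (laplace t u x)"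
  unfolding laplace_def by (rule nn_integral_eq_integral[OF integrable_exp_inner[OF assms]]) auto

lemma laplace_Chapman_Kolmogorov_le:
  assumes u: "u \<in> neg_cone I" and v: "v \<in> neg_cone I" and h: "h \<ge> 0" and s: "s \<ge> 0"
    and x: "x \<in> stateD I"
    and bound: "\<And>y. y \<in> stateD I \<Longrightarrow> laplace s u y \<le> exp (b + v \<bullet> y)"
  shows "laplace (h + s) u x \<le> exp b * laplace h v x"
proof -
  have "ennreal (laplace (h + s) u x) = (\<integral>\<^sup>+ y. \<integral>\<^sup>+ \<xi>. ennreal (exp (u \<bullet> \<xi>)) \<partial>p s y \<partial>p h x)"
    using nn_integral_exp_inner[OF u _ x, of "h + s"] nn_integral_Chapman_Kolmogorov[OF h s x] h s
    by simp
  also have "\<dots> \<le> (\<integral>\<^sup>+ y. ennreal (exp b) * ennreal (exp (v \<bullet> y)) \<partial>p h x)"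
  proof (rule nn_integral_mono_AE)
    show "AE y in p h x. (\<integral>\<^sup>+ \<xi>. ennreal (exp (u \<bullet> \<xi>)) \<partial>p s y)
        \<le> ennreal (exp b) * ennreal (exp (v \<bullet> y))"
      using AE_p[OF h x]
    proof eventually_elim
      case (elim y)
      then show ?case
        by (simp add: nn_integral_exp_inner[OF u s] bound ennreal_leI flip: ennreal_mult' exp_add)
    qed
  qed
  also have "\<dots> = ennreal (exp b * laplace h v x)"
    using h x by (simp add: nn_integral_cmult nn_integral_exp_inner[OF v h x] ennreal_mult')
  finally show ?thesis
    using laplace_pos[OF v h x] by (simp add: ennreal_le_iff)
qed

lemma laplace_le_exp_eventually:
  assumes u: "u \<in> neg_cone I" and c_pos: "0 < c" and z0: "z 0 = u"
    and z_cone: "\<forall>\<^sub>F h in at_right 0. z h \<in> neg_cone I"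
    and z: "\<And>k. k \<in> I \<Longrightarrow> ((\<lambda>h. z h $ k) has_real_derivative z' k) (at_right 0)"
    and super: "\<And>k. k \<in> I \<Longrightarrow> real_R (Some k) u < z' k"
  shows "\<forall>\<^sub>F h in at_right 0. \<forall>x\<in>stateD I. laplace h u x \<le> exp (c * h + z h \<bullet> x)"
proof -
  have "\<forall>\<^sub>F h in at_right 0. laplace_exponent0 h u < c * h"
    using real_R_None_nonpos[OF u] c_pos
    by (intro eventually_less_at_right[OF laplace_exponent0_has_right_derivative[OF u]
          DERIV_cmult_Id]) (auto simp: laplace_exponent_zero_time)
  moreover have "\<forall>\<^sub>F h in at_right 0. \<forall>k\<in>I. laplace_exponent h u k < z h $ k"
  proof (intro eventually_ball_finite ballI finite)
    fix k assume k: "k \<in> I"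
    show "\<forall>\<^sub>F h in at_right 0. laplace_exponent h u k < z h $ k"
      by (intro eventually_less_at_right[OF _ z[OF k] _ super[OF k]]
          laplace_exponent_has_right_derivative u) (simp add: laplace_exponent_zero_time z0)
  qed
  ultimately show ?thesis
    using z_cone eventually_at_right_less[of 0]
  proof eventually_elim
    case (elim h)
    show ?case
    proof
      fix x assume x: "x \<in> stateD I"
      have "laplace h u x = exp (laplace_exponent0 h u + (\<Sum>k\<in>I. laplace_exponent h u k * x $ k))"
        using elim by (intro laplace_exp_affine u x) simp
      also have "\<dots> \<le> exp (c * h + (\<Sum>k\<in>I. z h $ k * x $ k))"
        unfolding exp_le_cancel_iff using elim x
        by (intro add_mono sum_mono mult_right_mono) (auto simp: stateD_def less_imp_le)
      also have "(\<Sum>k\<in>I. z h $ k * x $ k) = z h \<bullet> x"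
        unfolding inner_vec_def using elim
        by (intro sum.mono_neutral_cong_left) (auto simp: neg_cone_def)
      finally show "laplace h u x \<le> exp (c * h + z h \<bullet> x)" .
    qed
  qed
qed

lemma closed_laplace_le_exp:
  assumes u: "u \<in> neg_cone I" and y: "continuous_on {0..\<tau>} y"
  shows "closed {t \<in> {0..\<tau>}. \<forall>x\<in>stateD I. laplace t u x \<le> exp (c * t + y t \<bullet> x)}"
proof -
  have "closed {t \<in> {0..\<tau>}. laplace t u x \<le> exp (c * t + y t \<bullet> x)}" if x: "x \<in> stateD I" for x
    by (intro continuous_on_closed_Collect_le continuous_intros y
        continuous_on_subset[OF continuous_on_laplace[OF u x]]) auto
  then have "closed (\<Inter>x\<in>stateD I. {t \<in> {0..\<tau>}. laplace t u x \<le> exp (c * t + y t \<bullet> x)})"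
    by (intro closed_INT) auto
  also have "\<dots> = {t \<in> {0..\<tau>}. \<forall>x\<in>stateD I. laplace t u x \<le> exp (c * t + y t \<bullet> x)}"
    using zero_in_stateD[of I] by blast
  finally show ?thesis .
qed

text \<open>By Chapman-Kolmogorov, continuing the bound past time \<open>s\<close> is a matter of small times only.\<close>

lemma laplace_le_exp_extend:
  assumes u: "u \<in> neg_cone I" and c_pos: "0 < c" and s: "0 \<le> s" "s < \<tau>"
    and y: "\<And>t. t \<in> {s..\<tau>} \<Longrightarrow> y t \<in> neg_cone I"
    and deriv: "\<And>k. k \<in> I \<Longrightarrow> ((\<lambda>t. y t $ k) has_real_derivative y' k) (at_right s)"
    and super: "\<And>k. k \<in> I \<Longrightarrow> real_R (Some k) (y s) < y' k"
    and bound: "\<And>x. x \<in> stateD I \<Longrightarrow> laplace s u x \<le> exp (c * s + y s \<bullet> x)"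
  shows "\<exists>t>s. t \<le> \<tau> \<and> (\<forall>x\<in>stateD I. laplace t u x \<le> exp (c * t + y t \<bullet> x))"
proof -
  have "\<forall>\<^sub>F h in at_right 0. 0 < h \<and> h < \<tau> - s"
    using s by (auto simp: eventually_at_right_field intro!: exI[of _ "\<tau> - s"])
  moreover from this have "\<forall>\<^sub>F h in at_right 0. y (s + h) \<in> neg_cone I"
    by eventually_elim (use y in auto)
  then have "\<forall>\<^sub>F h in at_right 0. \<forall>x\<in>stateD I. laplace h (y s) x \<le> exp (c * h + y (s + h) \<bullet> x)"
    using s y by (intro laplace_le_exp_eventually[of "y s" c "\<lambda>h. y (s + h)" y']
        has_right_derivative_shift deriv super c_pos) auto
  ultimately have "\<forall>\<^sub>F h in at_right 0. 0 < h \<and> h < \<tau> - s \<and>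
      (\<forall>x\<in>stateD I. laplace h (y s) x \<le> exp (c * h + y (s + h) \<bullet> x))"
    by eventually_elim simp
  then obtain h where h: "0 < h" "h < \<tau> - s"
    "\<And>x. x \<in> stateD I \<Longrightarrow> laplace h (y s) x \<le> exp (c * h + y (s + h) \<bullet> x)"
    using eventually_happens' trivial_limit_at_right_real by blast
  have "laplace (h + s) u x \<le> exp (c * (h + s) + y (h + s) \<bullet> x)" if x: "x \<in> stateD I" for x
  proof -
    have "laplace (h + s) u x \<le> exp (c * s) * laplace h (y s) x"
      using s h y by (intro laplace_Chapman_Kolmogorov_le[OF u _ _ _ x] bound) auto
    also have "\<dots> \<le> exp (c * s) * exp (c * h + y (s + h) \<bullet> x)"
      by (intro mult_left_mono h(3) x) simp
    finally show ?thesis by (simp add: algebra_simps flip: exp_add)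
  qed
  then show ?thesis using h by (intro exI[of _ "h + s"]) auto
qed

lemma laplace_supersolution_bound:
  assumes c_pos: "0 < c" and \<tau>: "0 \<le> \<tau>" and y: "\<And>t. t \<in> {0..\<tau>} \<Longrightarrow> y t \<in> neg_cone I"
    and cont: "continuous_on {0..\<tau>} y"
    and deriv: "\<And>t k. t \<in> {0..<\<tau>} \<Longrightarrow> k \<in> I \<Longrightarrow> ((\<lambda>t. y t $ k) has_real_derivative y' t k) (at_right t)"
    and super: "\<And>t k. t \<in> {0..<\<tau>} \<Longrightarrow> k \<in> I \<Longrightarrow> real_R (Some k) (y t) < y' t k"
    and x: "x \<in> stateD I"
  shows "laplace \<tau> (y 0) x \<le> exp (c * \<tau> + y \<tau> \<bullet> x)"
proof -
  have y0: "y 0 \<in> neg_cone I" using y \<tau> by simp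
  from \<tau> closed_laplace_le_exp[OF y0 cont]
  have "\<forall>x\<in>stateD I. laplace \<tau> (y 0) x \<le> exp (c * \<tau> + y \<tau> \<bullet> x)"
  proof (induction rule: interval_closed_induct)
    case base
    show ?case by (simp add: laplace_zero_time)
  next
    case (step s)
    then show ?case
      using y deriv super by (intro laplace_le_exp_extend[OF y0 c_pos, of s \<tau> y "y' s"]) auto
  qed
  with x show ?thesis by blast
qed

section \<open>Conservativeness\<close>

definition conservative :: bool where
  "conservative \<longleftrightarrow> (\<forall>t\<ge>0. \<forall>x\<in>stateD I. emeasure (p t x) (stateD I) = 1)"

definition riccati_solution :: "real \<Rightarrow> (real \<Rightarrow> real^'d) \<Rightarrow> bool" where
  "riccati_solution T g \<longleftrightarrow> g 0 = 0 \<and> (\<forall>t\<in>{0..<T}. g t \<in> neg_cone I \<and>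
     (\<forall>k\<in>I. ((\<lambda>s. g s $ k) has_real_derivative real_R (Some k) (g t)) (at t within {0..<T})))"

lemma riccati_solution_iff_complex:
  "riccati_solution T g \<longleftrightarrow> g 0 = 0 \<and>
     (\<forall>t\<in>{0..<T}. (\<forall>k. k \<notin> I \<longrightarrow> g t $ k = 0) \<and> (\<forall>k\<in>I. g t $ k \<le> 0) \<and>
        (\<forall>k\<in>I. ((\<lambda>s. complex_of_real (g s $ k)) has_vector_derivative
            R (Some k) (\<chi> l. complex_of_real (g t $ l))) (at t within {0..<T})))"
  unfolding riccati_solution_def neg_cone_def cvec_def[symmetric] R_cvec
    of_real_has_vector_derivative_iff
  by auto

lemma mass_eq_1_iff_fourier:
  assumes "t \<ge> 0" "x \<in> stateD I"
  shows "measure (p t x) UNIV = 1 \<longleftrightarrow> fourier t 0 x = 1"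
  unfolding of_real_mass_eq_fourier[OF assms, symmetric] by simp

lemma conservative_iff_fourier: "conservative \<longleftrightarrow> (\<forall>t\<ge>0. \<forall>x\<in>stateD I. fourier t 0 x = 1)"
proof -
  have "emeasure (p t x) (stateD I) = 1 \<longleftrightarrow> fourier t 0 x = 1" if "t \<ge> 0" "x \<in> stateD I" for t x
  proof -
    interpret finite_measure "p t x" by (rule finite_p[OF that])
    have "emeasure (p t x) (stateD I) = emeasure (p t x) UNIV"
      by (rule emeasure_eq_AE) (use AE_p[OF that] that in auto)
    then show ?thesis
      by (simp add: emeasure_eq_measure ennreal_eq_1 mass_eq_1_iff_fourier[OF that])
  qed
  then show ?thesis by (simp add: conservative_def)
qed

lemma Im_psi_zero:
  assumes t: "t \<ge> 0"
  shows "Im (psi t 0 $ k) = 0"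
proof (rule Im_eq_0_if_exp_nonneg)
  fix r :: real assume "0 \<le> r"
  then have axis: "axis k r \<in> stateD I" by (simp add: axis_in_stateD)
  let ?m = "\<lambda>x. measure (p t x) UNIV"
  have "fourier t 0 (axis k r) = fourier t 0 0 * exp (psi t 0 $ k * of_real r)"
    by (simp add: fourier_def pairing_axis exp_add)
  then have "complex_of_real (?m (axis k r)) = of_real (?m 0) * exp (psi t 0 $ k * of_real r)"
    by (simp only: of_real_mass_eq_fourier[OF t axis] of_real_mass_eq_fourier[OF t zero_in_stateD])
  then have "Re (complex_of_real (?m (axis k r)))
      = Re (of_real (?m 0) * exp (psi t 0 $ k * of_real r))"
    by (rule arg_cong)
  then have "?m (axis k r) = ?m 0 * Re (exp (psi t 0 $ k * of_real r))" by simp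
  then show "0 \<le> Re (exp (psi t 0 $ k * of_real r))"
    using mass_pos[OF t zero_in_stateD] mass_pos[OF t axis] by (simp add: zero_less_mult_iff)
qed

lemma cvec_Re_psi_zero: "t \<ge> 0 \<Longrightarrow> cvec (\<chi> k. Re (psi t 0 $ k)) = psi t 0"
  by (simp add: vec_eq_iff complex_eq_iff Im_psi_zero)

lemma riccati_solution_Re_psi: "riccati_solution T (\<lambda>t. \<chi> k. Re (psi t 0 $ k))"
  unfolding riccati_solution_def
proof (intro conjI ballI)
  show "(\<chi> k. Re (psi 0 0 $ k)) = 0" by (simp add: psi_zero_time vec_eq_iff)
  fix t assume t: "t \<in> {0..<T}"
  show "(\<chi> k. Re (psi t 0 $ k)) \<in> neg_cone I"
    using psi_in_left_cone[of t 0] t by (simp add: left_cone_def)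
  fix k
  have "((\<lambda>s. psi s 0 $ k) has_vector_derivative riccati (psi t 0) $ k) (at t within {0..})"
    using t
    by (intro bounded_linear.has_vector_derivative[OF bounded_linear_vec_nth]
        psi_has_vector_derivative) simp
  then have "((\<lambda>s. psi s 0 $ k) has_vector_derivative R (Some k) (psi t 0)) (at t within {0..<T})"
    unfolding riccati_def vec_lambda_beta by (rule has_vector_derivative_within_subset) auto
  then show "((\<lambda>s. (\<chi> k. Re (psi s 0 $ k)) $ k) has_real_derivative
      real_R (Some k) (\<chi> k. Re (psi t 0 $ k))) (at t within {0..<T})"
    using t R_cvec[of "Some k" "\<chi> k. Re (psi t 0 $ k)"] cvec_Re_psi_zero[of t]
    by (simp add: has_vector_derivative_complex_iff)
qed

lemma conservative_if_unique:
  assumes R_zero: "R None 0 = 0"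
    and unique: "\<And>T g. 0 < T \<Longrightarrow> riccati_solution T g \<Longrightarrow> \<forall>t\<in>{0..<T}. g t = 0"
  shows "conservative"
  unfolding conservative_iff_fourier
proof (intro allI impI ballI)
  fix t :: real and x assume t: "0 \<le> t" and "x \<in> stateD I"
  have psi: "psi s 0 = 0" if "0 \<le> s" for s
    using unique[of "s + 1", OF _ riccati_solution_Re_psi] cvec_Re_psi_zero[OF that] that
    by (simp add: cvec_def vec_eq_iff)
  have "norm (psi0 t 0 - psi0 0 0) \<le> 0 * t"
    by (rule norm_increment_le[OF ode_psi0 _ t]) (simp_all add: psi R_zero)
  then show "fourier t 0 x = 1" by (simp add: fourier_def psi t init_psi0)
qed

lemma conservative_imp_symbol_zero:
  assumes "conservative" and x: "x \<in> stateD I"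
  shows "symbol x 0 = 0"
proof -
  have fourier: "fourier t 0 x = 1" if "0 \<le> t" for t
    using assms that by (simp add: conservative_iff_fourier)
  have "((\<lambda>t. fourier t 0 x) has_vector_derivative symbol x 0) (at 0 within {0..})"
    using fourier_has_vector_derivative[of 0 0 x] by (simp add: fourier psi_zero_time)
  then have "((\<lambda>_. 1) has_vector_derivative symbol x 0) (at 0 within {0..})"
    by (rule has_vector_derivative_transform[rotated 2]) (simp_all add: fourier)
  then show ?thesis
    using vector_derivative_unique_within[of 0 "{0..}" "\<lambda>_. 1::complex" "symbol x 0" 0]
    by (simp add: at_within_Ici_at_right)
qed

lemma conservative_imp_R_zero:
  assumes "conservative"
  shows "R j 0 = 0"
proof (cases j)
  case None
  then show ?thesis using conservative_imp_symbol_zero[OF assms zero_in_stateD]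
    by (simp add: symbol_def)
next
  case (Some k)
  then show ?thesis
    using conservative_imp_symbol_zero[OF assms zero_in_stateD]
      conservative_imp_symbol_zero[OF assms axis_in_stateD[of 1 k]]
    by (simp add: symbol_def pairing_axis riccati_def)
qed

lemma laplace_tendsto_mass:
  assumes u: "u \<in> neg_cone I" and t: "t \<ge> 0" and x: "x \<in> stateD I"
    and \<epsilon>: "\<And>n. 0 \<le> \<epsilon> n" "\<epsilon> \<longlonglongrightarrow> 0"
  shows "(\<lambda>n. laplace t (\<epsilon> n *\<^sub>R u) x) \<longlonglongrightarrow> measure (p t x) UNIV"
proof -
  interpret finite_measure "p t x" by (rule finite_p[OF t x])
  have "(\<lambda>n. laplace t (\<epsilon> n *\<^sub>R u) x) \<longlonglongrightarrow> (\<integral>\<xi>. 1 \<partial>p t x)"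
    unfolding laplace_def
  proof (rule integral_dominated_convergence[where w = "\<lambda>_. 1"])
    show "AE \<xi> in p t x. norm (exp ((\<epsilon> n *\<^sub>R u) \<bullet> \<xi>)) \<le> 1" for n
      using AE_inner_p_nonpos[OF scaleR_in_neg_cone[OF \<epsilon>(1) u] t x] by simp
    have "(\<lambda>n. exp ((\<epsilon> n *\<^sub>R u) \<bullet> \<xi>)) \<longlonglongrightarrow> exp ((0 *\<^sub>R u) \<bullet> \<xi>)" for \<xi>
      by (intro tendsto_intros \<epsilon>)
    then show "AE \<xi> in p t x. (\<lambda>n. exp ((\<epsilon> n *\<^sub>R u) \<bullet> \<xi>)) \<longlonglongrightarrow> 1" by simp
  qed (use t x in auto)
  then show ?thesis using t x by simp
qed

definition neg_ones :: "real^'d" where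
  "neg_ones = (\<chi> k. if k \<in> I then -1 else 0)"

lemma neg_ones_in_neg_cone: "neg_ones \<in> neg_cone I"
  by (simp add: neg_ones_def neg_cone_def)

lemma riccati_solution_has_right_derivative:
  assumes g: "riccati_solution T g" and t: "t \<in> {0..<T}" and k: "k \<in> I"
  shows "((\<lambda>s. g s $ k) has_real_derivative real_R (Some k) (g t)) (at_right t)"
proof -
  have "((\<lambda>s. g s $ k) has_real_derivative real_R (Some k) (g t)) (at t within {t..(t + T) / 2})"
    by (rule has_field_derivative_subset[of _ _ _ "{0..<T}"])
       (use g t k in \<open>auto simp: riccati_solution_def\<close>)
  then show ?thesis using t by (simp add: at_within_Icc_at_right)
qed

lemma continuous_on_riccati_solution:
  assumes g: "riccati_solution T g"
  shows "continuous_on {0..<T} g"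
proof -
  have "continuous_on {0..<T} (\<lambda>t. g t $ k)" for k
  proof (cases "k \<in> I")
    case True
    show ?thesis by (rule DERIV_continuous_on) (use g True in \<open>auto simp: riccati_solution_def\<close>)
  next
    case False
    have "continuous_on {0..<T} (\<lambda>t. 0 :: real)" by simp
    then show ?thesis
      by (rule continuous_on_eq) (use g False in \<open>auto simp: riccati_solution_def neg_cone_def\<close>)
  qed
  then have "continuous_on {0..<T} (\<lambda>t. \<chi> k. g t $ k)" by (rule continuous_on_vec_lambda)
  then show ?thesis by simp
qed

lemma real_R_perturbed_less:
  assumes u: "u \<in> neg_cone I" and R_zero: "real_R j 0 = 0" and C: "real_R j neg_ones < C"
    and \<epsilon>: "0 < \<epsilon>" "\<epsilon> < 1" and r: "0 < r" "r \<le> 1"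
  shows "real_R j ((1 - \<epsilon>) *\<^sub>R u + \<epsilon> *\<^sub>R (r *\<^sub>R neg_ones)) < (1 - \<epsilon>) * real_R j u + \<epsilon> * (C * r)"
proof -
  have "real_R j (r *\<^sub>R neg_ones) \<le> r * real_R j neg_ones"
    using convex_onD[OF convex_on_real_R, of r 0 neg_ones j] r
    by (simp add: R_zero neg_ones_in_neg_cone)
  also have "\<dots> < C * r" using C r by simp
  finally have "\<epsilon> * real_R j (r *\<^sub>R neg_ones) < \<epsilon> * (C * r)" using \<epsilon> by simp
  moreover have "real_R j ((1 - \<epsilon>) *\<^sub>R u + \<epsilon> *\<^sub>R (r *\<^sub>R neg_ones))
      \<le> (1 - \<epsilon>) * real_R j u + \<epsilon> * real_R j (r *\<^sub>R neg_ones)"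
    by (rule convex_onD[OF convex_on_real_R])
       (use \<epsilon> r u in \<open>auto simp: scaleR_in_neg_cone neg_ones_in_neg_cone\<close>)
  ultimately show ?thesis by simp
qed

text \<open>Convexity of \<open>R\<close> makes \<open>(1 - \<epsilon>) g\<close> a supersolution up to an error that the decaying term
  with rate \<open>C\<close> exceeding \<open>R\<close> at \<open>neg_ones\<close> absorbs strictly.\<close>

lemma laplace_le_scaled_riccati_solution:
  assumes g: "riccati_solution T g" and R_zero: "\<And>k. real_R (Some k) 0 = 0"
    and \<epsilon>: "0 < \<epsilon>" "\<epsilon> < 1" and \<tau>: "0 \<le> \<tau>" "\<tau> < T" and x: "x \<in> stateD I"
  shows "laplace \<tau> (\<epsilon> *\<^sub>R neg_ones) x \<le> exp (\<epsilon> * \<tau> + (1 - \<epsilon>) * (g \<tau> \<bullet> x))"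
proof -
  define C where "C = 1 + (\<Sum>k\<in>I. \<bar>real_R (Some k) neg_ones\<bar>)"
  have C: "0 \<le> C" "\<And>k. k \<in> I \<Longrightarrow> real_R (Some k) neg_ones < C"
    using member_le_sum[of _ I "\<lambda>k. \<bar>real_R (Some k) neg_ones\<bar>"]
    by (fastforce simp: C_def intro: add_nonneg_nonneg sum_nonneg)+
  define y where "y t = (1 - \<epsilon>) *\<^sub>R g t + \<epsilon> *\<^sub>R (exp (- C * t) *\<^sub>R neg_ones)" for t
  have decay_cone: "exp (- C * t) *\<^sub>R neg_ones \<in> neg_cone I" for t
    by (simp add: scaleR_in_neg_cone neg_ones_in_neg_cone)
  have g_cone: "g t \<in> neg_cone I" if "t \<in> {0..\<tau>}" for t
    using g that \<tau> by (auto simp: riccati_solution_def)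
  have "laplace \<tau> (y 0) x \<le> exp (\<epsilon> * \<tau> + y \<tau> \<bullet> x)"
  proof (rule laplace_supersolution_bound[OF \<epsilon>(1) \<tau>(1) _ _ _ _ x])
    show "y t \<in> neg_cone I" if "t \<in> {0..\<tau>}" for t
      unfolding y_def using \<epsilon> by (intro convexD[OF convex_neg_cone g_cone[OF that] decay_cone]) auto
    show "continuous_on {0..\<tau>} y"
      unfolding y_def using \<tau>
      by (intro continuous_intros continuous_on_subset[OF continuous_on_riccati_solution[OF g]])
         auto
    fix t k assume t: "t \<in> {0..<\<tau>}" and k: "k \<in> I"
    have "((\<lambda>s. g s $ k) has_real_derivative real_R (Some k) (g t)) (at_right t)"
      by (rule riccati_solution_has_right_derivative[OF g _ k]) (use t \<tau> in auto)
    then show "((\<lambda>t. y t $ k) has_real_derivative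
        (1 - \<epsilon>) * real_R (Some k) (g t) + \<epsilon> * (C * exp (- C * t))) (at_right t)"
      using k unfolding y_def by (auto intro!: derivative_eq_intros simp: neg_ones_def)
    show "real_R (Some k) (y t) < (1 - \<epsilon>) * real_R (Some k) (g t) + \<epsilon> * (C * exp (- C * t))"
      unfolding y_def using t C by (intro real_R_perturbed_less g_cone R_zero C(2) k \<epsilon>) auto
  qed
  moreover have "y 0 = \<epsilon> *\<^sub>R neg_ones"
    using g by (simp add: y_def riccati_solution_def)
  moreover have "y \<tau> \<bullet> x \<le> (1 - \<epsilon>) * (g \<tau> \<bullet> x)"
    using \<epsilon> inner_neg_cone_stateD_nonpos[OF decay_cone x, of \<tau>]
    by (simp add: y_def inner_add_left mult.assoc mult_nonneg_nonpos)
  ultimately show ?thesis by (smt (verit) exp_le_cancel_iff)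
qed

lemma conservative_imp_unique:
  assumes cons: "conservative" and g: "riccati_solution T g" and \<tau>: "\<tau> \<in> {0..<T}"
  shows "g \<tau> = 0"
proof (rule neg_cone_eq_0)
  show "g \<tau> \<in> neg_cone I" using g \<tau> by (auto simp: riccati_solution_def)
  fix x assume x: "x \<in> stateD I"
  have R_zero: "real_R (Some k) 0 = 0" for k
    using conservative_imp_R_zero[OF cons, of "Some k"] R_cvec[of "Some k" 0] by simp
  define \<epsilon> where "\<epsilon> n = 1 / real (n + 2)" for n
  have \<epsilon>: "0 < \<epsilon> n" "\<epsilon> n < 1" for n by (auto simp: \<epsilon>_def)
  have lim: "\<epsilon> \<longlonglongrightarrow> 0" unfolding \<epsilon>_def by real_asymp
  have "measure (p \<tau> x) UNIV = 1"
    using cons \<tau> x by (simp add: conservative_iff_fourier mass_eq_1_iff_fourier)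
  then have "(\<lambda>n. laplace \<tau> (\<epsilon> n *\<^sub>R neg_ones) x) \<longlonglongrightarrow> 1"
    using laplace_tendsto_mass[OF neg_ones_in_neg_cone _ x less_imp_le[OF \<epsilon>(1)] lim, of \<tau>] \<tau> by simp
  moreover have "(\<lambda>n. exp (\<epsilon> n * \<tau> + (1 - \<epsilon> n) * (g \<tau> \<bullet> x))) \<longlonglongrightarrow> exp (0 * \<tau> + (1 - 0) * (g \<tau> \<bullet> x))"
    by (intro tendsto_intros lim)
  ultimately have "1 \<le> exp (0 * \<tau> + (1 - 0) * (g \<tau> \<bullet> x))"
    using laplace_le_scaled_riccati_solution[OF g R_zero \<epsilon> _ _ x] \<tau> by (intro LIMSEQ_le) auto
  then show "0 \<le> g \<tau> \<bullet> x" by simp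
qed

theorem conservative_iff_unique:
  "conservative \<longleftrightarrow> R None 0 = 0 \<and> \<not> (\<exists>T>0. \<exists>g. riccati_solution T g \<and> (\<exists>t\<in>{0..<T}. g t \<noteq> 0))"
  using conservative_if_unique conservative_imp_R_zero conservative_imp_unique by blast

end

theorem theorem3p4:
  fixes I :: "'d::finite set"
    and p :: "real \<Rightarrow> real^'d \<Rightarrow> (real^'d) measure"
    and psi0 :: "real \<Rightarrow> real^'d \<Rightarrow> complex"
    and psi :: "real \<Rightarrow> real^'d \<Rightarrow> complex^'d"
    and alpha :: "'d option \<Rightarrow> real^'d^'d" and beta :: "'d option \<Rightarrow> real^'d"
    and gamma :: "'d option \<Rightarrow> real" and kappa :: "'d option \<Rightarrow> (real^'d) measure"
  assumes markov: "transition_function I p"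
    and stoch_cont: "stoch_continuous I p"
    and affine: "affine_with I p psi0 psi"
    and adm: "admissible I alpha beta gamma kappa"
    and ode_psi: "\<And>v t. t \<ge> 0 \<Longrightarrow>
        ((\<lambda>s. psi s v) has_vector_derivative
           (\<chi> k. Rfun alpha beta gamma kappa (Some k) (psi t v))) (at t within {0..})"
    and init_psi: "\<And>v. psi 0 v = (\<chi> k. \<i> * of_real (v $ k))"
    and ode_psi0: "\<And>v t. t \<ge> 0 \<Longrightarrow>
        ((\<lambda>s. psi0 s v) has_vector_derivative
           Rfun alpha beta gamma kappa None (psi t v)) (at t within {0..})"
    and init_psi0: "\<And>v. psi0 0 v = 0"
  shows "((\<forall>t\<ge>0. \<forall>x\<in>stateD I. emeasure (p t x) (stateD I) = 1) \<longleftrightarrow>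
           (Rfun alpha beta gamma kappa None 0 = 0 \<and>
            \<not> (\<exists>T>0. \<exists>g :: real \<Rightarrow> real^'d.
                 g 0 = 0 \<and>
                 (\<forall>t\<in>{0..<T}. (\<forall>k. k \<notin> I \<longrightarrow> g t $ k = 0) \<and> (\<forall>k\<in>I. g t $ k \<le> 0) \<and>
                    (\<forall>k\<in>I. ((\<lambda>s. complex_of_real (g s $ k)) has_vector_derivative
                        Rfun alpha beta gamma kappa (Some k) (\<chi> l. complex_of_real (g t $ l)))
                        (at t within {0..<T}))) \<and>
                 (\<exists>t\<in>{0..<T}. g t \<noteq> 0))))
         \<and> ((\<forall>t\<ge>0. \<forall>x\<in>stateD I. emeasure (p t x) (stateD I) = 1) \<longrightarrow>
              (\<forall>k. Rfun alpha beta gamma kappa (Some k) 0 = 0))"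
proof -
  interpret affine_process I alpha beta gamma kappa p psi0 psi
    by unfold_locales (fact adm markov affine ode_psi init_psi ode_psi0 init_psi0)+
  have "conservative \<longrightarrow> (\<forall>k. R (Some k) 0 = 0)"
    by (simp add: conservative_imp_R_zero)
  with conservative_iff_unique show ?thesis
    unfolding conservative_def riccati_solution_iff_complex conj_assoc by (rule conjI)
qed

end
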